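(* Let $$R(\lambda)=\sum_{i=0}^{k-1}(A_i-\lambda B_i)f_i(\lambda)+\sum_{i=1}^{s}(C_i-\lambda D_i)\,a_i^T(E_i-\lambda F_i)^{-1}b_i\in\mathbb{C}(\lambda)^{n\times n},$$ with the data $A_i,B_i,C_i,D_i,f_i,a_i,b_i,E_i,F_i$ as described in the context, and let $$\mathcal{L}_R(\lambda)=\left[\begin{array}{c|c}\begin{array}{ccc}A_0-\lambda B_0&\cdots&A_{k-1}-\lambda B_{k-1}\end{array} & \begin{array}{ccc}a_1^T\otimes(C_1-\lambda D_1)&\cdots&a_s^T\otimes(C_s-\lambda D_s)\end{array}\\ (X-\lambda Y)\otimes I_n & 0\\ \hline \begin{array}{cc}-b\otimes I_n & 0\end{array} & (E-\lambda F)\otimes I_n\end{array}\right],$$ where $b:=[b_1^T\ \cdots\ b_s^T]^T$ and $E-\lambda F:=\operatorname{diag}(E_1-\lambda F_1,\ldots,E_s-\lambda F_s)$. Let $\Omega\subseteq\mathbb{C}$ be nonempty. If $\mathcal{L}_R(\lambda)$, viewed as a polynomial system matrix with state matrix $(E-\lambda F)\otimes I_n$, is minimal in $\Omega$, then $\mathcal{L}_R(\lambda)$ is a block full rank linearization of $R(\lambda)$ in $\Omega$ with state matrix $(E-\lambda F)\otimes I_n$.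
   Context: Data. $A_i,B_i$ ($0\le i\le k-1$) and $C_i,D_i$ ($1\le i\le s$) are constant matrices in $\mathbb{C}^{n\times n}$. The $f_i(\lambda)$ are scalar polynomials with $f_0(\lambda)\equiv1$, and $f(\lambda):=[f_0(\lambda)\ \cdots\ f_{k-1}(\lambda)]^T$ satisfies a linear relation $(X-\lambda Y)f(\lambda)=0$, where $X-\lambda Y$ is a $(k-1)\times k$ pencil with $\operatorname{rank}(X-\lambda Y)=k-1$ for all $\lambda\in\mathbb{C}$. For each $i=1,\dots,s$, $g_i$ is a scalar function, $z_1^i,\dots,z_{\ell_i}^i\in\mathbb{C}$ are distinct support points, $w_1^i,\dots,w_{\ell_i}^i\in\mathbb{C}$ are nonzero weights, $a_i=[g_i(z_1^i)w_1^i\ \cdots\ g_i(z_{\ell_i}^i)w_{\ell_i}^i]^T\in\mathbb{C}^{\ell_i}$, $b_i=[1\ 0\ \cdots\ 0]^T\in\mathbb{C}^{\ell_i}$, and $E_i-\lambda F_i$ is the (regular) $\ell_i\times\ell_i$ pencil $$E_i-\lambda F_i=\begin{bmatrix} w_1^i&w_2^i&\cdots&w_{\ell_i-1}^i&w_{\ell_i}^i\\ \lambda-z_1^i&z_2^i-\lambda\\ &\lambda-z_2^i&\ddots\\ &&\ddots&z_{\ell_i-1}^i-\lambda\\ &&&\lambda-z_{\ell_i-1}^i&z_{\ell_i}^i-\lambda\end{bmatrix}.$$ A pencil is a polynomial matrix of degree at most $1$. A rational matrix is defined in $\Omega$ if its entries (as irreducible fractions) have no poles in $\Omega$; a square rational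 matrix is invertible in $\Omega$ if it is defined in $\Omega$ and its determinant is nonzero at every point of $\Omega$; a $p\times m$ rational matrix has full row rank in $\Omega$ if it is defined in $\Omega$ and has rank $p$ at every point of $\Omega$. "Regular" means square with determinant not identically zero. Full row normal rank means full row rank over $\mathbb{C}(\lambda)$. Polynomial system matrix: a polynomial matrix which, after possibly permuting block rows and columns, is partitioned as $\begin{bmatrix}D(\lambda)&-C(\lambda)\\ B(\lambda)&A(\lambda)\end{bmatrix}$ with $A(\lambda)$ regular of size $N\times N$ (the state matrix); its transfer function matrix is $D(\lambda)+C(\lambda)A(\lambda)^{-1}B(\lambda)$. It is minimal in $\Omega$ if $\operatorname{rank}\begin{bmatrix}A(\lambda_0)\\ C(\lambda_0)\end{bmatrix}=\operatorname{rank}\begin{bmatrix}A(\lambda_0)&B(\lambda_0)\end{bmatrix}=N$ for all $\lambda_0\in\Omega$. For $\mathcal{L}_R(\lambda)$ the partition is the one indicated by the lines. Linearization in $\Omega$: a linear polynomial system matrix with state matrix $A(\lambda)$ and transfer function matrix $\widehat G(\lambda)\in\mathbb{C}(\lambda)^{q\times r}$ is a linearization of $G(\lambda)\in\mathbb{C}(\lambda)^{p\times m}$ in $\Omega$ with state matrix $A(\lambda)$ if (a) it is minimal in $\Omega$, and (b) there exist nonnegative integers $s_1,s_2$ with $s_1-s_2=q-p=r-m$ and rational matrices $R_1(\lambda),R_2(\lambda)$ of sizes $p+s_1$ and $m+s_1$, invertible in $\Omega$, such that $R_1(\lambda)\operatorname{diag}(G(\lambda),I_{s_1})R_2(\lambda)=\operatorname{diag}(\widehat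 G(\lambda),I_{s_2})$. Dual rational bases: $G(\lambda)\in\mathbb{C}(\lambda)^{p\times m}$ and $H(\lambda)\in\mathbb{C}(\lambda)^{q\times m}$ with full row normal rank, $p+q=m$ and $G(\lambda)H(\lambda)^T=0$. If one of them is empty, the other may be taken to be any square rational matrix of the appropriate size that is invertible in $\Omega$. Block full rank linearization of $R(\lambda)$ in $\Omega$ with state matrix $A(\lambda)$ ($A(\lambda)$ of size $N\times N$, $N>0$): a nonconstant linear polynomial system matrix of the form $$\left[\begin{array}{cc|c} M(\lambda)&K_2(\lambda)^T&-C(\lambda)\\ K_1(\lambda)&0&0\\ \hline B(\lambda)&0&A(\lambda)\end{array}\right]$$ with state matrix $A(\lambda)$, where $K_1,K_2$ are (possibly empty) pencils with full row normal rank, for which there are rational bases $N_1,N_2$ dual to $K_1,K_2$ such that $K_i,N_i$ have full row rank in $\Omega$ ($i=1,2$), $\operatorname{rank}\begin{bmatrix}A(\lambda_0)\\ -N_2(\lambda_0)C(\lambda_0)\end{bmatrix}=\operatorname{rank}\begin{bmatrix}A(\lambda_0)&B(\lambda_0)N_1(\lambda_0)^T\end{bmatrix}=N$ for all $\lambda_0\in\Omega$, and $R(\lambda)=N_2(\lambda)[M(\lambda)+C(\lambda)A(\lambda)^{-1}B(\lambda)]N_1(\lambda)^T$; such a pencil is, in particular, a linearization of $R(\lambda)$ in $\Omega$ with state matrix $A(\lambda)$.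
   Formalization: The pencil L_R is additionally assumed nonconstant, as the definition of block full rank linearization demands; without this the claim fails, e.g. for n=k=s=ℓ_1=1 and B_0=D_1=0, where L_R is constant yet minimal. *)

theory Defs
  imports
    "Jordan_Normal_Form.DL_Rank"
    "Jordan_Normal_Form.Gauss_Jordan_Elimination"
    "HOL-Computational_Algebra.Computational_Algebra"
    "HOL-Computational_Algebra.Field_as_Ring"
begin

section \<open>Matrices\<close>

abbreviation mrank :: "'a::field mat \<Rightarrow> nat" where
  "mrank A \<equiv> vec_space.rank (dim_row A) A"

definition append_cols :: "'a::zero mat \<Rightarrow> 'a mat \<Rightarrow> 'a mat" (infixr \<open>@\<^sub>c\<close> 65) where
  "A @\<^sub>c B = four_block_mat A B (0\<^sub>m 0 (dim_col A)) (0\<^sub>m 0 (dim_col B))"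

text \<open>The number of rows is an argument because it cannot be read off an empty list.\<close>

fun row_blocks :: "nat \<Rightarrow> 'a::zero mat list \<Rightarrow> 'a mat" where
  "row_blocks nr [] = 0\<^sub>m nr 0"
| "row_blocks nr (A # As) = A @\<^sub>c row_blocks nr As"

definition kron :: "'a::times mat \<Rightarrow> 'a mat \<Rightarrow> 'a mat" (infixl \<open>\<otimes>\<^sub>K\<close> 70) where
  "A \<otimes>\<^sub>K B = mat (dim_row A * dim_row B) (dim_col A * dim_col B)
     (\<lambda>(i, j). A $$ (i div dim_row B, j div dim_col B) * B $$ (i mod dim_row B, j mod dim_col B))"

text \<open>Junk value (\<open>the None\<close>) for singular arguments; it is only applied to regular ones.\<close>

definition inv_mat :: "'a::field mat \<Rightarrow> 'a mat" where
  "inv_mat A = the (mat_inverse A)"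

text \<open>Matrices are not an instance of \<open>comm_monoid_add\<close> (the zero depends on the
  dimensions), hence the entrywise sum.\<close>

definition mat_sum :: "nat \<Rightarrow> nat \<Rightarrow> 'i set \<Rightarrow> ('i \<Rightarrow> 'a::comm_monoid_add mat) \<Rightarrow> 'a mat" where
  "mat_sum nr nc I F = mat nr nc (\<lambda>(p, q). \<Sum>i\<in>I. F i $$ (p, q))"


section \<open>Polynomial and rational matrices\<close>

type_synonym pmat = "complex poly mat"
type_synonym rat_fun = "complex poly fract"
type_synonym rmat = "rat_fun mat"

definition const_pmat :: "complex mat \<Rightarrow> pmat" where
  "const_pmat A = map_mat (\<lambda>c. [:c:]) A"

text \<open>\<open>pencil A B\<close> is the polynomial matrix \<open>A - \<lambda>B\<close>.\<close>

definition pencil :: "complex mat \<Rightarrow> complex mat \<Rightarrow> pmat" where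
  "pencil A B = const_pmat A - [:0, 1:] \<cdot>\<^sub>m const_pmat B"

definition is_pencil :: "pmat \<Rightarrow> bool" where
  "is_pencil P \<longleftrightarrow> (\<forall>p\<in>elements_mat P. degree p \<le> 1)"

definition nonconstant :: "pmat \<Rightarrow> bool" where
  "nonconstant P \<longleftrightarrow> (\<exists>p\<in>elements_mat P. degree p \<noteq> 0)"

definition regular :: "pmat \<Rightarrow> bool" where
  "regular P \<longleftrightarrow> square_mat P \<and> det P \<noteq> 0"

definition peval :: "pmat \<Rightarrow> complex \<Rightarrow> complex mat" where
  "peval P x = map_mat (\<lambda>p. poly p x) P"

definition to_rmat :: "pmat \<Rightarrow> rmat" where
  "to_rmat P = map_mat to_fract P"

text \<open>\<open>quot_of_fract\<close> yields numerator and denominator of the irreducible fraction.\<close>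

definition rat_defined_at :: "rat_fun \<Rightarrow> complex \<Rightarrow> bool" where
  "rat_defined_at r x \<longleftrightarrow> poly (snd (quot_of_fract r)) x \<noteq> 0"

definition rat_eval :: "rat_fun \<Rightarrow> complex \<Rightarrow> complex" where
  "rat_eval r x = poly (fst (quot_of_fract r)) x / poly (snd (quot_of_fract r)) x"

definition defined_in :: "complex set \<Rightarrow> rmat \<Rightarrow> bool" where
  "defined_in \<Omega> G \<longleftrightarrow> (\<forall>r\<in>elements_mat G. \<forall>x\<in>\<Omega>. rat_defined_at r x)"

definition reval :: "rmat \<Rightarrow> complex \<Rightarrow> complex mat" where
  "reval G x = map_mat (\<lambda>r. rat_eval r x) G"

definition full_row_rank_in :: "complex set \<Rightarrow> rmat \<Rightarrow> bool" where
  "full_row_rank_in \<Omega> G \<longleftrightarrow> defined_in \<Omega> G \<and> (\<forall>x\<in>\<Omega>. mrank (reval G x) = dim_row G)"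

definition full_row_normal_rank :: "rmat \<Rightarrow> bool" where
  "full_row_normal_rank G \<longleftrightarrow> mrank G = dim_row G"

text \<open>If \<open>G\<close> has no rows, the conditions say that \<open>H\<close> is square and invertible over
  \<open>\<complex>(\<lambda>)\<close>. Together with \<open>full_row_rank_in \<Omega> H\<close>, which is required wherever dual bases are
  used below, this is the usual convention that the dual of an empty basis is an arbitrary
  square rational matrix invertible in \<open>\<Omega>\<close>.\<close>

definition dual_rational_bases :: "rmat \<Rightarrow> rmat \<Rightarrow> bool" where
  "dual_rational_bases G H \<longleftrightarrow>
     dim_col G = dim_col H \<and> dim_row G + dim_row H = dim_col G \<and>
     full_row_normal_rank G \<and> full_row_normal_rank H \<and>
     G * transpose_mat H = 0\<^sub>m (dim_row G) (dim_row H)"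


section \<open>System matrices and block full rank linearizations\<close>

text \<open>The partition always has the state matrix \<open>A\<close> in the lower right corner, so no
  permutation of block rows and columns is involved. Given \<open>L\<close> and \<open>A\<close>, the blocks
  \<open>D\<close>, \<open>C\<close>, \<open>B\<close> are uniquely determined.\<close>

definition system_matrix :: "pmat \<Rightarrow> pmat \<Rightarrow> pmat \<Rightarrow> pmat \<Rightarrow> pmat \<Rightarrow> bool" where
  "system_matrix L D C B A \<longleftrightarrow>
     regular A \<and>
     C \<in> carrier_mat (dim_row D) (dim_row A) \<and>
     B \<in> carrier_mat (dim_row A) (dim_col D) \<and>
     L = four_block_mat D (- C) B A"

definition minimal_in :: "complex set \<Rightarrow> pmat \<Rightarrow> pmat \<Rightarrow> bool" where
  "minimal_in \<Omega> L A \<longleftrightarrow>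
     (\<exists>D C B. system_matrix L D C B A \<and>
        (\<forall>x\<in>\<Omega>. mrank (peval A x @\<^sub>r peval C x) = dim_row A \<and>
                mrank (peval A x @\<^sub>c peval B x) = dim_row A))"

definition block_full_rank_linearization :: "complex set \<Rightarrow> pmat \<Rightarrow> rmat \<Rightarrow> pmat \<Rightarrow> bool" where
  "block_full_rank_linearization \<Omega> L R A \<longleftrightarrow>
     is_pencil L \<and> nonconstant L \<and> dim_row A > 0 \<and>
     (\<exists>M K1 K2 B C N1 N2.
        M \<in> carrier_mat (dim_col K2) (dim_col K1) \<and>
        B \<in> carrier_mat (dim_row A) (dim_col K1) \<and>
        C \<in> carrier_mat (dim_col K2) (dim_row A) \<and>
        system_matrix L
          (four_block_mat M (transpose_mat K2) K1 (0\<^sub>m (dim_row K1) (dim_row K2)))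
          (C @\<^sub>r 0\<^sub>m (dim_row K1) (dim_row A))
          (B @\<^sub>c 0\<^sub>m (dim_row A) (dim_row K2))
          A \<and>
        is_pencil K1 \<and> is_pencil K2 \<and>
        full_row_normal_rank (to_rmat K1) \<and> full_row_normal_rank (to_rmat K2) \<and>
        dual_rational_bases (to_rmat K1) N1 \<and> dual_rational_bases (to_rmat K2) N2 \<and>
        full_row_rank_in \<Omega> (to_rmat K1) \<and> full_row_rank_in \<Omega> (to_rmat K2) \<and>
        full_row_rank_in \<Omega> N1 \<and> full_row_rank_in \<Omega> N2 \<and>
        (\<forall>x\<in>\<Omega>. mrank (peval A x @\<^sub>r (- (reval N2 x * peval C x))) = dim_row A \<and>
                mrank (peval A x @\<^sub>c (peval B x * transpose_mat (reval N1 x))) = dim_row A) \<and>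
        R = N2 * (to_rmat M + to_rmat C * inv_mat (to_rmat A) * to_rmat B) * transpose_mat N1)"


section \<open>The rational matrix and its pencil\<close>

text \<open>Support points and weights are numbered from \<open>1\<close>, matrix indices start at \<open>0\<close>:
  column \<open>q\<close> carries \<open>z (Suc q)\<close> and \<open>w (Suc q)\<close>.\<close>

definition EF_pencil :: "nat \<Rightarrow> (nat \<Rightarrow> complex) \<Rightarrow> (nat \<Rightarrow> complex) \<Rightarrow> pmat" where
  "EF_pencil l z w = mat l l (\<lambda>(p, q).
     if p = 0 then [:w (Suc q):]
     else if p = Suc q then [:- z (Suc q), 1:]
     else if p = q then [:z (Suc q), - 1:]
     else 0)"

definition a_col :: "nat \<Rightarrow> (complex \<Rightarrow> complex) \<Rightarrow> (nat \<Rightarrow> complex) \<Rightarrow> (nat \<Rightarrow> complex) \<Rightarrow> complex mat" where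
  "a_col l g z w = mat l 1 (\<lambda>(q, _). g (z (Suc q)) * w (Suc q))"

definition b_col :: "nat \<Rightarrow> complex mat" where
  "b_col l = mat l 1 (\<lambda>(q, _). if q = 0 then 1 else 0)"

text \<open>\<open>E - \<lambda>F = diag(E\<^sub>1 - \<lambda>F\<^sub>1, \<dots>, E\<^sub>s - \<lambda>F\<^sub>s)\<close> and \<open>(E - \<lambda>F) \<otimes> I\<^sub>n\<close>\<close>

definition EF_diag :: "nat \<Rightarrow> (nat \<Rightarrow> nat) \<Rightarrow> (nat \<Rightarrow> nat \<Rightarrow> complex) \<Rightarrow> (nat \<Rightarrow> nat \<Rightarrow> complex) \<Rightarrow> pmat" where
  "EF_diag s l z w = diag_block_mat (map (\<lambda>i. EF_pencil (l i) (z i) (w i)) [1..<Suc s])"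

definition state_mat :: "nat \<Rightarrow> nat \<Rightarrow> (nat \<Rightarrow> nat) \<Rightarrow> (nat \<Rightarrow> nat \<Rightarrow> complex) \<Rightarrow> (nat \<Rightarrow> nat \<Rightarrow> complex) \<Rightarrow> pmat" where
  "state_mat n s l z w = EF_diag s l z w \<otimes>\<^sub>K 1\<^sub>m n"

definition b_stack :: "nat \<Rightarrow> (nat \<Rightarrow> nat) \<Rightarrow> complex mat" where
  "b_stack s l = transpose_mat (row_blocks 1 (map (\<lambda>i. transpose_mat (b_col (l i))) [1..<Suc s]))"

definition R_mat ::
  "nat \<Rightarrow> nat \<Rightarrow> nat \<Rightarrow> (nat \<Rightarrow> complex mat) \<Rightarrow> (nat \<Rightarrow> complex mat) \<Rightarrow>
   (nat \<Rightarrow> complex mat) \<Rightarrow> (nat \<Rightarrow> complex mat) \<Rightarrow> (nat \<Rightarrow> complex poly) \<Rightarrow>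
   (nat \<Rightarrow> nat) \<Rightarrow> (nat \<Rightarrow> complex \<Rightarrow> complex) \<Rightarrow>
   (nat \<Rightarrow> nat \<Rightarrow> complex) \<Rightarrow> (nat \<Rightarrow> nat \<Rightarrow> complex) \<Rightarrow> rmat" where
  "R_mat n k s A B C D f l g z w =
     mat_sum n n {..<k} (\<lambda>i. to_fract (f i) \<cdot>\<^sub>m to_rmat (pencil (A i) (B i))) +
     mat_sum n n {1..s} (\<lambda>i.
       (to_rmat (const_pmat (transpose_mat (a_col (l i) (g i) (z i) (w i))))
          * inv_mat (to_rmat (EF_pencil (l i) (z i) (w i)))
          * to_rmat (const_pmat (b_col (l i)))) $$ (0, 0)
       \<cdot>\<^sub>m to_rmat (pencil (C i) (D i)))"

definition L_mat ::
  "nat \<Rightarrow> nat \<Rightarrow> nat \<Rightarrow> (nat \<Rightarrow> complex mat) \<Rightarrow> (nat \<Rightarrow> complex mat) \<Rightarrow>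
   (nat \<Rightarrow> complex mat) \<Rightarrow> (nat \<Rightarrow> complex mat) \<Rightarrow> complex mat \<Rightarrow> complex mat \<Rightarrow>
   (nat \<Rightarrow> nat) \<Rightarrow> (nat \<Rightarrow> complex \<Rightarrow> complex) \<Rightarrow>
   (nat \<Rightarrow> nat \<Rightarrow> complex) \<Rightarrow> (nat \<Rightarrow> nat \<Rightarrow> complex) \<Rightarrow> pmat" where
  "L_mat n k s A B C D X Y l g z w =
     (let St = state_mat n s l z w; N = dim_row St in
      four_block_mat
        (row_blocks n (map (\<lambda>i. pencil (A i) (B i)) [0..<k])
           @\<^sub>r (pencil X Y \<otimes>\<^sub>K 1\<^sub>m n))
        (row_blocks n
             (map (\<lambda>i. const_pmat (transpose_mat (a_col (l i) (g i) (z i) (w i)))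
                        \<otimes>\<^sub>K pencil (C i) (D i)) [1..<Suc s])
           @\<^sub>r 0\<^sub>m ((k - 1) * n) N)
        ((- const_pmat (b_stack s l) \<otimes>\<^sub>K 1\<^sub>m n) @\<^sub>c 0\<^sub>m N ((k - 1) * n))
        St)"

end

theory Submission
  imports Defs
begin

text \<open>
  It suffices to choose an empty second basis: \<open>K\<^sub>2\<close> has no rows and its dual is
  \<open>N\<^sub>2 = I\<^sub>n\<close>, while \<open>K\<^sub>1 = (X - \<lambda>Y) \<otimes> I\<^sub>n\<close> has the dual
  \<open>N\<^sub>1 = f\<^sup>T \<otimes> I\<^sub>n\<close>. Duality is the relation \<open>(X - \<lambda>Y) f = 0\<close>, tensored with
  \<open>I\<^sub>n\<close>, and right inverses of \<open>X - \<lambda>Y\<close>, tensored with \<open>I\<^sub>n\<close>, are right inverses of \<open>K\<^sub>1\<close>.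
  The rest about \<open>N\<^sub>1\<close> comes from \<open>f\<^sub>0 = 1\<close>: with the unit row \<open>u = [1 0 \<dots> 0]\<close> one has
  \<open>u f = 1\<close>. So \<open>N\<^sub>1\<close> has the constant right inverse \<open>u\<^sup>T \<otimes> I\<^sub>n\<close>, hence full row rank at
  every point. Moreover the block
  \<open>B = [- b \<otimes> I\<^sub>n, 0]\<close> of the system matrix factors as \<open>(- b \<otimes> I\<^sub>n)(u \<otimes> I\<^sub>n)\<close>, and
  \<open>B N\<^sub>1\<^sup>T = - b \<otimes> I\<^sub>n\<close>.

  This factorization explains why minimality of the whole system matrix implies the two rank
  conditions of a block full rank linearization. The kernel of a column of blocks \<open>[A; G C]\<close>
  contains that of \<open>[A; C]\<close>, and the columns of \<open>[A, B\<^sub>0 G]\<close> are combinations of the columns of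
  \<open>[A, B\<^sub>0]\<close>; so full rank passes from the blocks padded with zeros to the blocks
  without them. Full row rank is always handled through right inverses and full
  column rank through trivial kernels (\<open>mrank_full_row_iff_right_inverse\<close>,
  \<open>mrank_full_col_iff_trivial_kernel\<close>). The argument is carried out for arbitrary polynomial
  blocks in \<open>one_sided_block_full_rank_linearization\<close>.

  The transfer function is computed with the mixed product rule \<open>kron_mult\<close>. Write
  \<open>P\<^sub>i = A\<^sub>i - \<lambda>B\<^sub>i\<close>, \<open>Q\<^sub>i = C\<^sub>i - \<lambda>D\<^sub>i\<close> and \<open>S\<^sub>i = E\<^sub>i - \<lambda>F\<^sub>i\<close>. The polynomial part is
  \<open>[P\<^sub>0 \<dots> P\<^bsub>k-1\<^esub>](f \<otimes> I\<^sub>n) = \<Sum> f\<^sub>i P\<^sub>i\<close>. For the rational part the inverse of the state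
  matrix \<open>diag(S\<^sub>1, \<dots>, S\<^sub>s) \<otimes> I\<^sub>n\<close> is applied by solving a linear system: the stack \<open>v\<close> of the
  columns \<open>v\<^sub>i = S\<^sub>i\<^sup>-\<^sup>1 b\<^sub>i\<close> satisfies
  \<open>(diag(S\<^sub>1, \<dots>, S\<^sub>s) \<otimes> I\<^sub>n)(v \<otimes> I\<^sub>n) = b \<otimes> I\<^sub>n\<close>, and multiplying \<open>v \<otimes> I\<^sub>n\<close> by the row
  of the blocks \<open>a\<^sub>i\<^sup>T \<otimes> Q\<^sub>i\<close> gives \<open>\<Sum> (a\<^sub>i\<^sup>T v\<^sub>i) Q\<^sub>i\<close>
  (\<open>block_diagonal_transfer_function\<close>). Regularity of each \<open>S\<^sub>i\<close> is inherited from the state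
  matrix.
\<close>

section \<open>Full row rank and full column rank\<close>

context vec_space begin

text \<open>The library evaluates the rank as the size of a maximal independent set of columns
  (\<open>rank_card_indpt\<close>); this supplies such a set.\<close>
lemma obtain_maximal_indpt_cols:
  obtains S where "maximal S (\<lambda>T. T \<subseteq> set (cols A) \<and> lin_indpt T)"
  using maximal_exists[of "\<lambda>T. T \<subseteq> set (cols A) \<and> lin_indpt T" "card (set (cols A))" "{}"]
  by (meson List.finite_set card_mono empty_iff empty_subsetI finite_lin_indpt2 rev_finite_subset)

text \<open>Repeated columns need separate attention, because independence is a property of the set of
  columns. They lower the rank, and they also give a kernel vector, the difference of two unit
  vectors.\<close>
lemma full_col_rank_iff_trivial_kernel:
  assumes A: "A \<in> carrier_mat n nc"
  shows "rank A = nc \<longleftrightarrow> (\<forall>v\<in>carrier_vec nc. A *\<^sub>v v = 0\<^sub>v n \<longrightarrow> v = 0\<^sub>v nc)"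
proof
  assume r: "rank A = nc"
  obtain S where S: "maximal S (\<lambda>T. T \<subseteq> set (cols A) \<and> lin_indpt T)"
    by (rule obtain_maximal_indpt_cols)
  have "card S = nc" using rank_card_indpt[OF A S] r by simp
  moreover have "card S \<le> card (set (cols A))"
    using S by (intro card_mono) (auto simp: maximal_def)
  ultimately have "card (set (cols A)) = length (cols A)"
    using A card_length[of "cols A"] by auto
  then have d: "distinct (cols A)" by (simp add: card_distinct)
  show "\<forall>v\<in>carrier_vec nc. A *\<^sub>v v = 0\<^sub>v n \<longrightarrow> v = 0\<^sub>v nc"
    using lin_depI[OF A _ _ _ d] full_rank_lin_indpt[OF A r d] by blast
next
  assume k: "\<forall>v\<in>carrier_vec nc. A *\<^sub>v v = 0\<^sub>v n \<longrightarrow> v = 0\<^sub>v nc"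
  have d: "distinct (cols A)"
  proof (rule ccontr)
    assume "\<not> distinct (cols A)"
    then obtain i j where ij: "i < nc" "j < nc" "i \<noteq> j" "col A i = col A j"
      using A by (auto simp: distinct_conv_nth)
    have unit: "A *\<^sub>v unit_vec nc j = col A j" if "j < nc" for j
      using A that by (intro eq_vecI) (auto simp: scalar_prod_right_unit)
    have "A *\<^sub>v (unit_vec nc i - unit_vec nc j) = A *\<^sub>v unit_vec nc i - A *\<^sub>v unit_vec nc j"
      using A by (intro mult_minus_distrib_mat_vec) auto
    also have "\<dots> = 0\<^sub>v n"
      using A ij unit[of i] unit[of j] by auto
    finally have "unit_vec nc i - unit_vec nc j = (0\<^sub>v nc :: 'a vec)"
      using k by auto
    then have "(unit_vec nc i - unit_vec nc j) $ i = (0\<^sub>v nc :: 'a vec) $ i" by simp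
    then show False using ij by simp
  qed
  then have "lin_indpt (set (cols A))" using lin_depE[OF A _ d] k by blast
  then show "rank A = nc" by (rule lin_indpt_full_rank[OF A d])
qed

lemma full_row_rank_iff_spanning:
  assumes A: "A \<in> carrier_mat n nc"
  shows "rank A = n \<longleftrightarrow> span (set (cols A)) = carrier_vec n"
proof
  have sub: "set (cols A) \<subseteq> carrier_vec n" using A cols_dim by blast
  {
    assume r: "rank A = n"
    obtain S where S: "maximal S (\<lambda>T. T \<subseteq> set (cols A) \<and> lin_indpt T)"
      by (rule obtain_maximal_indpt_cols)
    then have S': "finite S" "S \<subseteq> carrier_vec n" "lin_indpt S"
      using sub by (auto simp: maximal_def intro: finite_subset)
    moreover have "dim \<le> card S" using rank_card_indpt[OF A S] r dim_is_n by simp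
    ultimately have "basis S" using dim_li_is_basis[OF fin_dim, of S] by simp
    then have "carrier_vec n = span S" by (auto simp: basis_def)
    also have "\<dots> \<subseteq> span (set (cols A))" using S by (intro span_is_monotone) (auto simp: maximal_def)
    finally show "span (set (cols A)) = carrier_vec n" using span_is_subset2[OF sub] by auto
  }
  assume "span (set (cols A)) = carrier_vec n"
  then have "span_vs (set (cols A)) = V" by simp
  then show "rank A = n" by (simp add: rank_def dim_is_n)
qed

end

text \<open>The columns of a right inverse are preimages of the unit vectors. Right inverses
  multiply under products and Kronecker products, so full row rank is used in this form below.\<close>
lemma mrank_full_row_iff_right_inverse:
  fixes A :: "'a::field mat"
  assumes A: "A \<in> carrier_mat nr nc"
  shows "mrank A = nr \<longleftrightarrow> (\<exists>Q\<in>carrier_mat nc nr. A * Q = 1\<^sub>m nr)"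
proof -
  interpret vec_space "TYPE('a)" nr .
  have sp: "span (set (cols A)) = {y \<in> carrier_vec nr. \<exists>x\<in>carrier_vec nc. A *\<^sub>v x = y}"
    using col_space_eq[OF A] A by (simp add: col_space_def)
  have "span (set (cols A)) = carrier_vec nr \<longleftrightarrow> (\<exists>Q\<in>carrier_mat nc nr. A * Q = 1\<^sub>m nr)"
  proof
    assume "span (set (cols A)) = carrier_vec nr"
    then have "\<forall>i. \<exists>x\<in>carrier_vec nc. A *\<^sub>v x = unit_vec nr i"
      using sp unit_vec_carrier[of nr] by blast
    then obtain q where q: "\<And>i. q i \<in> carrier_vec nc" "\<And>i. A *\<^sub>v q i = unit_vec nr i" by metis
    define Q where "Q = mat_of_cols nc (map q [0..<nr])"
    have Q: "Q \<in> carrier_mat nc nr" by (auto simp: Q_def)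
    have "A * Q = 1\<^sub>m nr"
    proof (rule mat_col_eqI)
      fix i assume "i < dim_col (1\<^sub>m nr :: 'a mat)"
      then have i: "i < nr" by simp
      have "col Q i = q i" using i q(1) by (simp add: Q_def)
      then show "col (A * Q) i = col (1\<^sub>m nr) i" unfolding col_mult2[OF A Q i] using i q(2) by simp
    qed (use A Q in auto)
    with Q show "\<exists>Q\<in>carrier_mat nc nr. A * Q = 1\<^sub>m nr" by blast
  next
    assume "\<exists>Q\<in>carrier_mat nc nr. A * Q = 1\<^sub>m nr"
    then obtain Q where Q: "Q \<in> carrier_mat nc nr" "A * Q = 1\<^sub>m nr" by blast
    have "A *\<^sub>v (Q *\<^sub>v y) = y" if "y \<in> carrier_vec nr" for y
      using that A Q by (metis assoc_mult_mat_vec one_mult_mat_vec)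
    then show "span (set (cols A)) = carrier_vec nr"
      unfolding sp using Q by (auto intro!: bexI[of _ "Q *\<^sub>v _"])
  qed
  then show ?thesis using full_row_rank_iff_spanning[OF A] A by simp
qed

lemma mrank_full_col_iff_trivial_kernel:
  fixes A :: "'a::field mat"
  assumes A: "A \<in> carrier_mat nr nc"
  shows "mrank A = nc \<longleftrightarrow> (\<forall>v\<in>carrier_vec nc. A *\<^sub>v v = 0\<^sub>v nr \<longrightarrow> v = 0\<^sub>v nc)"
  using vec_space.full_col_rank_iff_trivial_kernel[OF A] A by simp

section \<open>Block matrices\<close>

lemma dim_append_rows [simp]:
  "dim_row (A @\<^sub>r B) = dim_row A + dim_row B" "dim_col (A @\<^sub>r B) = dim_col A"
  by (simp_all add: append_rows_def)

lemma dim_append_cols [simp]: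
  "dim_row (A @\<^sub>c B) = dim_row A" "dim_col (A @\<^sub>c B) = dim_col A + dim_col B"
  by (simp_all add: append_cols_def)

lemma index_append_rows [simp]:
  "i < dim_row A + dim_row B \<Longrightarrow> j < dim_col A \<Longrightarrow>
    (A @\<^sub>r B) $$ (i, j) = (if i < dim_row A then A $$ (i, j) else B $$ (i - dim_row A, j))"
  by (simp add: append_rows_def)

lemma index_append_cols [simp]:
  "i < dim_row A \<Longrightarrow> j < dim_col A + dim_col B \<Longrightarrow>
    (A @\<^sub>c B) $$ (i, j) = (if j < dim_col A then A $$ (i, j) else B $$ (i, j - dim_col A))"
  by (simp add: append_cols_def)

lemma append_cols_carrier [simp, intro]:
  "A \<in> carrier_mat nr nc1 \<Longrightarrow> B \<in> carrier_mat nr nc2 \<Longrightarrow> A @\<^sub>c B \<in> carrier_mat nr (nc1 + nc2)"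
  by (intro carrier_matI) (auto dest: carrier_matD)

lemma append_cols_mult_append_rows:
  fixes A :: "'a::semiring_0 mat"
  assumes "A \<in> carrier_mat nr n1" "B \<in> carrier_mat nr n2"
    and "P \<in> carrier_mat n1 nc" "Q \<in> carrier_mat n2 nc"
  shows "(A @\<^sub>c B) * (P @\<^sub>r Q) = A * P + B * Q"
proof -
  have "(A @\<^sub>c B) * (P @\<^sub>r Q) =
    four_block_mat (A * P + B * Q) (A * 0\<^sub>m n1 0 + B * 0\<^sub>m n2 0)
      (0\<^sub>m 0 n1 * P + 0\<^sub>m 0 n2 * Q) (0\<^sub>m 0 n1 * 0\<^sub>m n1 0 + 0\<^sub>m 0 n2 * 0\<^sub>m n2 0)"
    unfolding append_cols_def append_rows_def
    using assms by (subst mult_four_block_mat[of _ nr n1 _ n2 _ 0 _ _ nc _ 0]) auto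
  also have "\<dots> = A * P + B * Q" by (rule eq_matI) (use assms in auto)
  finally show ?thesis .
qed

lemma mult_append_cols:
  fixes A :: "'a::semiring_0 mat"
  assumes "A \<in> carrier_mat nr n" "P \<in> carrier_mat n nc1" "Q \<in> carrier_mat n nc2"
  shows "A * (P @\<^sub>c Q) = (A * P) @\<^sub>c (A * Q)"
proof (rule mat_col_eqI)
  fix j assume "j < dim_col ((A * P) @\<^sub>c (A * Q))"
  then have j: "j < nc1 + nc2" using assms by simp
  show "col (A * (P @\<^sub>c Q)) j = col ((A * P) @\<^sub>c (A * Q)) j"
  proof (rule eq_vecI)
    fix i assume "i < dim_vec (col ((A * P) @\<^sub>c (A * Q)) j)"
    then have i: "i < nr" using assms by simp
    have "col (P @\<^sub>c Q) j = (if j < nc1 then col P j else col Q (j - nc1))"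
      using assms j by (intro eq_vecI) auto
    then show "col (A * (P @\<^sub>c Q)) j $ i = col ((A * P) @\<^sub>c (A * Q)) j $ i"
      using assms i j by auto
  qed (use assms in auto)
qed (use assms in auto)

lemma append_rows_mult:
  fixes A :: "'a::semiring_0 mat"
  assumes "A \<in> carrier_mat nr1 n" "B \<in> carrier_mat nr2 n" "P \<in> carrier_mat n nc"
  shows "(A @\<^sub>r B) * P = (A * P) @\<^sub>r (B * P)"
proof (rule eq_rowI)
  fix i assume "i < dim_row ((A * P) @\<^sub>r (B * P))"
  then have i: "i < nr1 + nr2" using assms by simp
  show "row ((A @\<^sub>r B) * P) i = row ((A * P) @\<^sub>r (B * P)) i"
  proof (rule eq_vecI)
    fix j assume "j < dim_vec (row ((A * P) @\<^sub>r (B * P)) i)"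
    then have j: "j < nc" using assms by simp
    have "row (A @\<^sub>r B) i = (if i < nr1 then row A i else row B (i - nr1))"
      using assms i by (intro eq_vecI) auto
    then show "row ((A @\<^sub>r B) * P) i $ j = row ((A * P) @\<^sub>r (B * P)) i $ j"
      using assms i j by auto
  qed (use assms in auto)
qed (use assms in auto)

lemma split_rows:
  assumes "W \<in> carrier_mat (n1 + n2) nc"
  obtains W1 W2 where "W1 \<in> carrier_mat n1 nc" "W2 \<in> carrier_mat n2 nc" "W = W1 @\<^sub>r W2"
proof
  show "W = mat n1 nc (\<lambda>(i, j). W $$ (i, j)) @\<^sub>r mat n2 nc (\<lambda>(i, j). W $$ (n1 + i, j))"
    using assms by (intro eq_matI) auto
qed auto

text \<open>The vertical counterpart of \<open>row_blocks\<close>.\<close>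
fun col_blocks :: "nat \<Rightarrow> 'a::zero mat list \<Rightarrow> 'a mat" where
  "col_blocks nc [] = 0\<^sub>m 0 nc"
| "col_blocks nc (A # As) = A @\<^sub>r col_blocks nc As"

lemma col_blocks_carrier:
  assumes "\<And>A. A \<in> set As \<Longrightarrow> dim_col A = nc"
  shows "col_blocks nc As \<in> carrier_mat (sum_list (map dim_row As)) nc"
  using assms by (induction As) (auto intro!: carrier_matI)

lemma row_blocks_carrier:
  assumes "\<And>A. A \<in> set As \<Longrightarrow> dim_row A = nr"
  shows "row_blocks nr As \<in> carrier_mat nr (sum_list (map dim_col As))"
  using assms by (induction As) (auto intro!: carrier_matI)

lemma row_blocks_map_carrier:
  assumes "\<And>i. i \<in> set is \<Longrightarrow> F i \<in> carrier_mat nr (m i)"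
  shows "row_blocks nr (map F is) \<in> carrier_mat nr (sum_list (map m is))"
  using assms by (induction "is") auto

lemma col_blocks_map_carrier:
  assumes "\<And>i. i \<in> set is \<Longrightarrow> G i \<in> carrier_mat (m i) nc"
  shows "col_blocks nc (map G is) \<in> carrier_mat (sum_list (map m is)) nc"
  using assms by (induction "is") auto

lemma diag_block_mat_map_carrier:
  assumes "\<And>i. i \<in> set is \<Longrightarrow> E i \<in> carrier_mat (m i) (m i)"
  shows "diag_block_mat (map E is) \<in> carrier_mat (sum_list (map m is)) (sum_list (map m is))"
  using assms by (induction "is") (auto simp: Let_def)

lemma transpose_row_blocks:
  assumes "\<And>A. A \<in> set As \<Longrightarrow> dim_row A = nr"
  shows "transpose_mat (row_blocks nr As) = col_blocks nr (map transpose_mat As)"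
  using assms
proof (induction As)
  case (Cons A As)
  have "transpose_mat (A @\<^sub>c B) = transpose_mat A @\<^sub>r transpose_mat B" if "dim_row B = dim_row A" for B
    by (rule eq_matI) (use that in auto)
  moreover have "dim_row (row_blocks nr As) = nr" using row_blocks_carrier[of As nr] Cons.prems by auto
  ultimately show ?case using Cons by simp
qed simp

text \<open>The recursion along which block products are summed.\<close>
lemma mat_sum_insert:
  fixes F :: "'i \<Rightarrow> 'a::comm_monoid_add mat"
  assumes "finite I" "i \<notin> I" "F i \<in> carrier_mat nr nc"
  shows "mat_sum nr nc (insert i I) F = F i + mat_sum nr nc I F"
proof (rule eq_matI)
  fix p q assume "p < dim_row (F i + mat_sum nr nc I F)" "q < dim_col (F i + mat_sum nr nc I F)"
  then have "p < nr" "q < nc" by (auto simp: mat_sum_def)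
  then show "mat_sum nr nc (insert i I) F $$ (p, q) = (F i + mat_sum nr nc I F) $$ (p, q)"
    using assms by (simp add: mat_sum_def)
qed (use assms in \<open>auto simp: mat_sum_def\<close>)

lemma row_blocks_mult_col_blocks:
  fixes F :: "'i \<Rightarrow> 'a::semiring_0 mat"
  assumes "distinct is"
    and "\<And>i. i \<in> set is \<Longrightarrow> F i \<in> carrier_mat nr (m i)"
    and "\<And>i. i \<in> set is \<Longrightarrow> G i \<in> carrier_mat (m i) nc"
  shows "row_blocks nr (map F is) * col_blocks nc (map G is) = mat_sum nr nc (set is) (\<lambda>i. F i * G i)"
  using assms
proof (induction "is")
  case Nil
  show ?case by (rule eq_matI) (auto simp: mat_sum_def scalar_prod_def)
next
  case (Cons i "is")
  have "row_blocks nr (map F is) \<in> carrier_mat nr (sum_list (map m is))"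
    by (rule row_blocks_map_carrier) (use Cons.prems in auto)
  moreover have "col_blocks nc (map G is) \<in> carrier_mat (sum_list (map m is)) nc"
    by (rule col_blocks_map_carrier) (use Cons.prems in auto)
  ultimately have "row_blocks nr (map F (i # is)) * col_blocks nc (map G (i # is)) =
    F i * G i + row_blocks nr (map F is) * col_blocks nc (map G is)"
    using append_cols_mult_append_rows[of "F i" nr "m i" "row_blocks nr (map F is)" _ "G i" nc] Cons.prems
    by simp
  also have "\<dots> = F i * G i + mat_sum nr nc (set is) (\<lambda>i. F i * G i)" using Cons by simp
  also have "\<dots> = mat_sum nr nc (set (i # is)) (\<lambda>i. F i * G i)"
    using Cons.prems mult_carrier_mat[of "F i" nr "m i" "G i" nc] by (simp add: mat_sum_insert)
  finally show ?case .
qed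

lemma diag_block_mat_mult_col_blocks:
  fixes E :: "'i \<Rightarrow> 'a::semiring_0 mat"
  assumes "\<And>i. i \<in> set is \<Longrightarrow> E i \<in> carrier_mat (m i) (m i)"
    and "\<And>i. i \<in> set is \<Longrightarrow> V i \<in> carrier_mat (m i) nc"
  shows "diag_block_mat (map E is) * col_blocks nc (map V is) = col_blocks nc (map (\<lambda>i. E i * V i) is)"
  using assms
proof (induction "is")
  case Nil
  show ?case by (rule eq_matI) auto
next
  case (Cons i "is")
  let ?k = "sum_list (map m is)"
  have Ei: "E i \<in> carrier_mat (m i) (m i)" and Vi: "V i \<in> carrier_mat (m i) nc" using Cons.prems by auto
  have D: "diag_block_mat (map E is) \<in> carrier_mat ?k ?k"
    by (rule diag_block_mat_map_carrier) (use Cons.prems in auto)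
  have W: "col_blocks nc (map V is) \<in> carrier_mat ?k nc"
    by (rule col_blocks_map_carrier) (use Cons.prems in auto)
  \<comment> \<open>Read by rows, the diagonal block matrix lets the row-wise product rule act on each part.\<close>
  have "diag_block_mat (map E (i # is)) = (E i @\<^sub>c 0\<^sub>m (m i) ?k) @\<^sub>r (0\<^sub>m ?k (m i) @\<^sub>c diag_block_mat (map E is))"
    using D Ei by (intro eq_matI) (auto simp: Let_def)
  then have "diag_block_mat (map E (i # is)) * col_blocks nc (map V (i # is)) =
    ((E i @\<^sub>c 0\<^sub>m (m i) ?k) * (V i @\<^sub>r col_blocks nc (map V is))) @\<^sub>r
    ((0\<^sub>m ?k (m i) @\<^sub>c diag_block_mat (map E is)) * (V i @\<^sub>r col_blocks nc (map V is)))"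
    using D W Ei Vi by (simp add: append_rows_mult[of _ "m i" "m i + ?k" _ ?k _ nc])
  also have "(E i @\<^sub>c 0\<^sub>m (m i) ?k) * (V i @\<^sub>r col_blocks nc (map V is)) =
      E i * V i + 0\<^sub>m (m i) ?k * col_blocks nc (map V is)"
    using D W Ei Vi by (intro append_cols_mult_append_rows[of _ "m i" "m i" _ ?k]) auto
  also have "\<dots> = E i * V i"
    using W mult_carrier_mat[OF Ei Vi] by simp
  also have "(0\<^sub>m ?k (m i) @\<^sub>c diag_block_mat (map E is)) * (V i @\<^sub>r col_blocks nc (map V is)) =
      0\<^sub>m ?k (m i) * V i + diag_block_mat (map E is) * col_blocks nc (map V is)"
    using D W Ei Vi by (intro append_cols_mult_append_rows[of _ ?k "m i" _ ?k]) auto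
  also have "\<dots> = diag_block_mat (map E is) * col_blocks nc (map V is)"
    using W Vi mult_carrier_mat[OF D W] by simp
  also have "\<dots> = col_blocks nc (map (\<lambda>i. E i * V i) is)" using Cons by simp
  finally show ?case by simp
qed

lemma det_diag_block_mat:
  fixes As :: "'a::idom mat list"
  assumes "\<And>A. A \<in> set As \<Longrightarrow> square_mat A"
  shows "det (diag_block_mat As) = prod_list (map det As)"
  using assms
proof (induction As)
  case (Cons A As)
  let ?D = "diag_block_mat As"
  have "square_mat ?D" using Cons.prems by (intro diag_block_mat_square) auto
  then have D: "?D \<in> carrier_mat (dim_row ?D) (dim_row ?D)" by (intro carrier_matI) auto
  have A: "A \<in> carrier_mat (dim_row A) (dim_row A)" using Cons.prems by (intro carrier_matI) auto
  have "det (diag_block_mat (A # As)) = det A * det ?D"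
    using det_four_block_mat_upper_right_zero[OF A refl zero_carrier_mat D] carrier_matD[OF A] carrier_matD[OF D]
    by (simp add: Let_def)
  then show ?case using Cons by simp
qed simp

lemma map_mat_append_rows:
  assumes "dim_col B = dim_col A"
  shows "map_mat h (A @\<^sub>r B) = map_mat h A @\<^sub>r map_mat h B"
  by (rule eq_matI) (use assms in auto)

lemma map_mat_append_cols:
  assumes "dim_row B = dim_row A"
  shows "map_mat h (A @\<^sub>c B) = map_mat h A @\<^sub>c map_mat h B"
  by (rule eq_matI) (use assms in auto)

lemma map_mat_row_blocks:
  assumes "\<And>A. A \<in> set As \<Longrightarrow> dim_row A = nr"
  shows "map_mat h (row_blocks nr As) = row_blocks nr (map (map_mat h) As)"
  using assms
proof (induction As)
  case (Cons A As)
  then show ?case using row_blocks_carrier[of As nr] by (simp add: map_mat_append_cols)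
qed (auto intro: eq_matI)

lemma map_mat_col_blocks:
  assumes "\<And>A. A \<in> set As \<Longrightarrow> dim_col A = nc"
  shows "map_mat h (col_blocks nc As) = col_blocks nc (map (map_mat h) As)"
  using assms
proof (induction As)
  case (Cons A As)
  then show ?case using col_blocks_carrier[of As nc] by (simp add: map_mat_append_rows)
qed (auto intro: eq_matI)

lemma map_mat_diag_block_mat:
  assumes "h 0 = 0"
  shows "map_mat h (diag_block_mat As) = diag_block_mat (map (map_mat h) As)"
proof (induction As)
  case (Cons A As)
  have "map_mat h (diag_block_mat (A # As)) =
    four_block_mat (map_mat h A) (0\<^sub>m (dim_row A) (dim_col (diag_block_mat As)))
      (0\<^sub>m (dim_row (diag_block_mat As)) (dim_col A)) (map_mat h (diag_block_mat As))"
    using assms by (intro eq_matI) (auto simp: Let_def)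
  also have "\<dots> = diag_block_mat (map (map_mat h) (A # As))"
    using Cons[symmetric] by (simp add: Let_def)
  finally show ?case .
qed (auto intro: eq_matI)

lemma col_mat_eq_col_blocks:
  "mat (length xs) 1 (\<lambda>(i, _). xs ! i) = col_blocks 1 (map (\<lambda>x. mat 1 1 (\<lambda>_. x)) xs)"
proof (induction xs)
  case (Cons x xs)
  have "mat (length (x # xs)) 1 (\<lambda>(i, _). (x # xs) ! i) = mat 1 1 (\<lambda>_. x) @\<^sub>r mat (length xs) 1 (\<lambda>(i, _). xs ! i)"
    by (rule eq_matI) (auto simp: nth_Cons')
  then show ?case using Cons by simp
qed (auto intro: eq_matI)

lemma mat_sum_cong:
  assumes "\<And>i. i \<in> I \<Longrightarrow> F i = G i"
  shows "mat_sum nr nc I F = mat_sum nr nc I G"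
  using assms by (auto simp: mat_sum_def intro!: eq_matI sum.cong)

lemma (in comm_monoid_add_hom) map_mat_mat_sum:
  assumes "\<And>i. i \<in> I \<Longrightarrow> F i \<in> carrier_mat nr nc"
  shows "map_mat hom (mat_sum nr nc I F) = mat_sum nr nc I (\<lambda>i. map_mat hom (F i))"
proof (rule eq_matI)
  fix p q assume "p < dim_row (mat_sum nr nc I (\<lambda>i. map_mat hom (F i)))" "q < dim_col (mat_sum nr nc I (\<lambda>i. map_mat hom (F i)))"
  then have pq: "p < nr" "q < nc" by (auto simp: mat_sum_def)
  have "map_mat hom (F i) $$ (p, q) = hom (F i $$ (p, q))" if "i \<in> I" for i
    using assms[OF that] pq by simp
  then show "map_mat hom (mat_sum nr nc I F) $$ (p, q) = mat_sum nr nc I (\<lambda>i. map_mat hom (F i)) $$ (p, q)"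
    using pq by (simp add: mat_sum_def hom_sum)
qed (auto simp: mat_sum_def)

text \<open>The two signs come from the convention that the upper right block of a system matrix is
  \<open>- C\<close>: it is \<open>- C\<close> itself that occurs in the observability condition of a block full rank
  linearization, so that block is exhibited as the right factor.\<close>
lemma append_rows_zero_eq:
  fixes A :: "'a::comm_ring_1 mat"
  assumes A: "A \<in> carrier_mat n m"
  shows "A @\<^sub>r 0\<^sub>m r m = (- (1\<^sub>m n @\<^sub>r 0\<^sub>m r n)) * (- A)"
proof -
  have G: "1\<^sub>m n @\<^sub>r 0\<^sub>m r n \<in> carrier_mat (n + r) n" by auto
  have "(- (1\<^sub>m n @\<^sub>r 0\<^sub>m r n)) * (- A) = (1\<^sub>m n @\<^sub>r 0\<^sub>m r n) * A"
    using uminus_mult_left_mat uminus_mult_right_mat A G by auto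
  also have "\<dots> = (1\<^sub>m n * A) @\<^sub>r (0\<^sub>m r n * A)"
    by (rule append_rows_mult[OF _ _ A]) auto
  finally show ?thesis using A by simp
qed

text \<open>Minimality only asserts that some partition exists; once the state matrix is fixed, the
  other blocks can be read off.\<close>
lemma four_block_mat_off_diagonal_inj:
  assumes eq: "four_block_mat A B C D = four_block_mat A' B' C' D"
    and "A \<in> carrier_mat p q" "B \<in> carrier_mat p (dim_col D)" "C \<in> carrier_mat (dim_row D) q"
    and "A' \<in> carrier_mat p q" "B' \<in> carrier_mat p (dim_col D)" "C' \<in> carrier_mat (dim_row D) q"
  shows "B = B'" "C = C'"
proof -
  have "B $$ (i, j) = B' $$ (i, j)" if "i < p" "j < dim_col D" for i j
    using arg_cong[OF eq, of "\<lambda>X. X $$ (i, q + j)"] assms(2-) that by simp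
  then show "B = B'" using assms(2-) by (intro eq_matI) auto
  have "C $$ (i, j) = C' $$ (i, j)" if "i < dim_row D" "j < q" for i j
    using arg_cong[OF eq, of "\<lambda>X. X $$ (p + i, j)"] assms(2-) that by simp
  then show "C = C'" using assms(2-) by (intro eq_matI) auto
qed

section \<open>Kronecker products\<close>

lemma dim_kron [simp]:
  "dim_row (A \<otimes>\<^sub>K B) = dim_row A * dim_row B" "dim_col (A \<otimes>\<^sub>K B) = dim_col A * dim_col B"
  by (simp_all add: kron_def)

lemma kron_carrier [simp, intro]:
  "A \<in> carrier_mat a b \<Longrightarrow> B \<in> carrier_mat c d \<Longrightarrow> A \<otimes>\<^sub>K B \<in> carrier_mat (a * c) (b * d)"
  by (intro carrier_matI) (auto dest: carrier_matD)

lemma index_kron [simp]: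
  "i < dim_row A * dim_row B \<Longrightarrow> j < dim_col A * dim_col B \<Longrightarrow>
    (A \<otimes>\<^sub>K B) $$ (i, j) = A $$ (i div dim_row B, j div dim_col B) * B $$ (i mod dim_row B, j mod dim_col B)"
  by (simp add: kron_def)

lemma kron_index_bounds:
  fixes i a b :: nat
  assumes "i < a * b"
  shows "i div b < a" "i mod b < b"
  using assms by (auto simp: less_mult_imp_div_less intro!: mod_less_divisor gr0I)

text \<open>Row and column indices of a Kronecker product are numbers \<open>i b + r\<close> with \<open>r < b\<close>; a sum
  over them is a double sum over quotient and remainder.\<close>
lemma sum_div_mod:
  fixes F :: "nat \<Rightarrow> nat \<Rightarrow> 'a::comm_monoid_add"
  shows "(\<Sum>j<a * b. F (j div b) (j mod b)) = (\<Sum>i<a. \<Sum>r<b. F i r)"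
proof -
  have "(\<Sum>j = i * b..<i * b + b. F (j div b) (j mod b)) = (\<Sum>r<b. F i r)" for i
  proof -
    have "(\<Sum>r<b. F i r) = (\<Sum>r = 0..<b. F ((r + i * b) div b) ((r + i * b) mod b))"
      by (intro sum.cong) auto
    also have "\<dots> = (\<Sum>j = 0 + i * b..<b + i * b. F (j div b) (j mod b))"
      by (rule sum.shift_bounds_nat_ivl[symmetric])
    finally show ?thesis by (simp add: add.commute)
  qed
  then show ?thesis using sum.nat_group[of "\<lambda>j. F (j div b) (j mod b)" b a] by simp
qed

lemma kron_mult:
  fixes A :: "'a::comm_semiring_1 mat"
  assumes A: "A \<in> carrier_mat a b" and B: "B \<in> carrier_mat a' b'"
    and P: "P \<in> carrier_mat b c" and Q: "Q \<in> carrier_mat b' c'"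
  shows "(A \<otimes>\<^sub>K B) * (P \<otimes>\<^sub>K Q) = (A * P) \<otimes>\<^sub>K (B * Q)"
proof (rule eq_matI)
  fix i j assume "i < dim_row ((A * P) \<otimes>\<^sub>K (B * Q))" "j < dim_col ((A * P) \<otimes>\<^sub>K (B * Q))"
  then have i: "i < a * a'" and j: "j < c * c'" using A B P Q by auto
  note bd = kron_index_bounds[OF i] kron_index_bounds[OF j]
  have "((A \<otimes>\<^sub>K B) * (P \<otimes>\<^sub>K Q)) $$ (i, j) = (\<Sum>k<b * b'. (A \<otimes>\<^sub>K B) $$ (i, k) * (P \<otimes>\<^sub>K Q) $$ (k, j))"
    using A B P Q i j by (simp add: scalar_prod_def lessThan_atLeast0)
  also have "\<dots> = (\<Sum>k<b * b'. (A $$ (i div a', k div b') * P $$ (k div b', j div c')) *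
      (B $$ (i mod a', k mod b') * Q $$ (k mod b', j mod c')))"
    using A B P Q i j by (intro sum.cong) (auto simp: mult_ac)
  also have "\<dots> = (\<Sum>r<b. \<Sum>t<b'. (A $$ (i div a', r) * P $$ (r, j div c')) *
      (B $$ (i mod a', t) * Q $$ (t, j mod c')))"
    by (rule sum_div_mod[of "\<lambda>r t. (A $$ (i div a', r) * P $$ (r, j div c')) * (B $$ (i mod a', t) * Q $$ (t, j mod c'))"])
  also have "\<dots> = (\<Sum>r<b. A $$ (i div a', r) * P $$ (r, j div c')) * (\<Sum>t<b'. B $$ (i mod a', t) * Q $$ (t, j mod c'))"
    by (simp add: sum_product)
  also have "\<dots> = ((A * P) \<otimes>\<^sub>K (B * Q)) $$ (i, j)"
    using A B P Q i j bd by (simp add: scalar_prod_def lessThan_atLeast0)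
  finally show "((A \<otimes>\<^sub>K B) * (P \<otimes>\<^sub>K Q)) $$ (i, j) = ((A * P) \<otimes>\<^sub>K (B * Q)) $$ (i, j)" .
qed (use A B P Q in auto)

lemma (in semiring_hom) mat_hom_kron: "map_mat hom (A \<otimes>\<^sub>K B) = map_mat hom A \<otimes>\<^sub>K map_mat hom B"
  by (rule eq_matI) (auto simp: kron_index_bounds hom_mult)

lemma kron_one_one: "1\<^sub>m a \<otimes>\<^sub>K 1\<^sub>m b = (1\<^sub>m (a * b) :: 'a::comm_semiring_1 mat)"
proof (rule eq_matI)
  fix i j assume "i < dim_row (1\<^sub>m (a * b) :: 'a mat)" "j < dim_col (1\<^sub>m (a * b) :: 'a mat)"
  then have ij: "i < a * b" "j < a * b" by auto
  have "(i div b = j div b \<and> i mod b = j mod b) = (i = j)" by (metis div_mult_mod_eq)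
  then show "(1\<^sub>m a \<otimes>\<^sub>K 1\<^sub>m b) $$ (i, j) = (1\<^sub>m (a * b) :: 'a mat) $$ (i, j)"
    using ij by (auto simp: kron_index_bounds)
qed auto

lemma kron_zero_left: "0\<^sub>m a b \<otimes>\<^sub>K B = (0\<^sub>m (a * dim_row B) (b * dim_col B) :: 'a::comm_semiring_1 mat)"
  by (rule eq_matI) (auto simp: kron_index_bounds)

text \<open>This is how the scalars \<open>f\<^sub>i\<close> and \<open>a\<^sub>i\<^sup>T S\<^sub>i\<^sup>-\<^sup>1 b\<^sub>i\<close> emerge from the block products.\<close>
lemma kron_1x1_left:
  fixes B :: "'a::comm_semiring_1 mat"
  assumes "A \<in> carrier_mat 1 1"
  shows "A \<otimes>\<^sub>K B = A $$ (0, 0) \<cdot>\<^sub>m B"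
  using assms by (intro eq_matI) auto

lemma kron_append_rows:
  assumes "dim_col B = dim_col A"
  shows "(A @\<^sub>r B) \<otimes>\<^sub>K P = (A \<otimes>\<^sub>K P) @\<^sub>r (B \<otimes>\<^sub>K P)"
proof (rule eq_matI)
  fix i j assume "i < dim_row ((A \<otimes>\<^sub>K P) @\<^sub>r (B \<otimes>\<^sub>K P))" "j < dim_col ((A \<otimes>\<^sub>K P) @\<^sub>r (B \<otimes>\<^sub>K P))"
  then have i: "i < (dim_row A + dim_row B) * dim_row P" and j: "j < dim_col A * dim_col P"
    by (auto simp: algebra_simps)
  then have p: "dim_row P > 0" by (auto intro: gr0I)
  note bd = kron_index_bounds[OF i] kron_index_bounds[OF j]
  have lt: "i div dim_row P < dim_row A \<longleftrightarrow> i < dim_row A * dim_row P"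
    using p by (simp add: div_less_iff_less_mult)
  have ge: "(i - dim_row A * dim_row P) div dim_row P = i div dim_row P - dim_row A"
    "(i - dim_row A * dim_row P) mod dim_row P = i mod dim_row P" if "\<not> i < dim_row A * dim_row P"
  proof -
    have r: "i = dim_row A * dim_row P + (i - dim_row A * dim_row P)" using that by simp
    define t where "t = i - dim_row A * dim_row P"
    note r = r[folded t_def]
    show "(i - dim_row A * dim_row P) div dim_row P = i div dim_row P - dim_row A"
      "(i - dim_row A * dim_row P) mod dim_row P = i mod dim_row P"
      using p by (simp_all add: r)
  qed
  show "((A @\<^sub>r B) \<otimes>\<^sub>K P) $$ (i, j) = ((A \<otimes>\<^sub>K P) @\<^sub>r (B \<otimes>\<^sub>K P)) $$ (i, j)"
    using i j bd lt ge assms by (auto simp: algebra_simps)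
qed (use assms in \<open>auto simp: algebra_simps\<close>)

lemma kron_col_blocks:
  assumes "\<And>A. A \<in> set As \<Longrightarrow> dim_col A = nc"
  shows "col_blocks nc As \<otimes>\<^sub>K P = col_blocks (nc * dim_col P) (map (\<lambda>A. A \<otimes>\<^sub>K P) As)"
  using assms
proof (induction As)
  case (Cons A As)
  then show ?case using col_blocks_carrier[of As nc] by (simp add: kron_append_rows)
qed (auto intro: eq_matI)

section \<open>Inverses and ranks of composed matrices\<close>

lemma inv_mat_inverse:
  fixes A :: "'a::field mat"
  assumes A: "A \<in> carrier_mat n n" and "det A \<noteq> 0"
  shows "inv_mat A \<in> carrier_mat n n" "A * inv_mat A = 1\<^sub>m n" "inv_mat A * A = 1\<^sub>m n"
proof -
  have "A \<in> Units (ring_mat TYPE('a) n ())" by (rule det_non_zero_imp_unit[OF assms])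
  then obtain B where "mat_inverse A = Some B" using mat_inverse(1)[OF A, of "()"] by auto
  then show "inv_mat A \<in> carrier_mat n n" "A * inv_mat A = 1\<^sub>m n" "inv_mat A * A = 1\<^sub>m n"
    using mat_inverse(2)[OF A] by (auto simp: inv_mat_def)
qed

text \<open>A vector killed by \<open>A\<close> and \<open>C\<close> is killed by \<open>A\<close> and \<open>G C\<close>.\<close>
lemma mrank_append_rows_factor:
  fixes A :: "'a::field mat"
  assumes A: "A \<in> carrier_mat p nc" and C: "C \<in> carrier_mat q nc" and G: "G \<in> carrier_mat r q"
    and rank: "mrank (A @\<^sub>r (G * C)) = nc"
  shows "mrank (A @\<^sub>r C) = nc"
proof -
  have GC: "G * C \<in> carrier_mat r nc" using G C by simp
  have "v = 0\<^sub>v nc" if v: "v \<in> carrier_vec nc" and 0: "(A @\<^sub>r C) *\<^sub>v v = 0\<^sub>v (p + q)" for v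
  proof -
    have app: "0\<^sub>v (p + m) = (0\<^sub>v p @\<^sub>v 0\<^sub>v m :: 'a vec)" for m by (intro eq_vecI) auto
    have "A *\<^sub>v v = 0\<^sub>v p" "C *\<^sub>v v = 0\<^sub>v q"
      using 0 A C v unfolding mat_mult_append[OF A C v] app by (auto simp: append_vec_eq[of _ p])
    moreover have "G *\<^sub>v 0\<^sub>v q = 0\<^sub>v r" using G by (intro eq_vecI) (auto simp: scalar_prod_def)
    ultimately have "(A @\<^sub>r (G * C)) *\<^sub>v v = 0\<^sub>v (p + r)"
      unfolding mat_mult_append[OF A GC v] app using G C v by simp
    then show ?thesis
      using rank mrank_full_col_iff_trivial_kernel[OF carrier_append_rows[OF A GC]] v by blast
  qed
  then show ?thesis
    using mrank_full_col_iff_trivial_kernel[OF carrier_append_rows[OF A C]] by blast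
qed

text \<open>The dual fact: from a right inverse \<open>[W\<^sub>1; W\<^sub>2]\<close> of \<open>[A, B G]\<close> one gets the right inverse
  \<open>[W\<^sub>1; G W\<^sub>2]\<close> of \<open>[A, B]\<close>.\<close>
lemma mrank_append_cols_factor:
  fixes A :: "'a::field mat"
  assumes A: "A \<in> carrier_mat nr p" and B: "B \<in> carrier_mat nr q" and G: "G \<in> carrier_mat q r"
    and rank: "mrank (A @\<^sub>c (B * G)) = nr"
  shows "mrank (A @\<^sub>c B) = nr"
proof -
  have BG: "B * G \<in> carrier_mat nr r" using G B by simp
  obtain W where W: "W \<in> carrier_mat (p + r) nr" "(A @\<^sub>c (B * G)) * W = 1\<^sub>m nr"
    using rank mrank_full_row_iff_right_inverse[OF append_cols_carrier[OF A BG]] by blast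
  obtain W1 W2 where W12: "W1 \<in> carrier_mat p nr" "W2 \<in> carrier_mat r nr" "W = W1 @\<^sub>r W2"
    using split_rows[OF W(1)] by blast
  have "(A @\<^sub>c B) * (W1 @\<^sub>r (G * W2)) = A * W1 + B * (G * W2)"
    using A B G W12 by (intro append_cols_mult_append_rows) auto
  also have "B * (G * W2) = B * G * W2" using B G W12 by simp
  also have "A * W1 + B * G * W2 = 1\<^sub>m nr"
    using append_cols_mult_append_rows[OF A BG W12(1,2)] W(2) W12(3) by simp
  finally show ?thesis
    using mrank_full_row_iff_right_inverse[OF append_cols_carrier[OF A B]] W12 G
    by (auto intro!: bexI[of _ "W1 @\<^sub>r (G * W2)"])
qed

lemma mrank_kron_one:
  fixes A :: "'a::field mat"
  assumes A: "A \<in> carrier_mat nr nc" and rank: "mrank A = nr"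
  shows "mrank (A \<otimes>\<^sub>K 1\<^sub>m n) = nr * n"
proof -
  obtain Q where Q: "Q \<in> carrier_mat nc nr" "A * Q = 1\<^sub>m nr"
    using rank mrank_full_row_iff_right_inverse[OF A] by blast
  have "(A \<otimes>\<^sub>K 1\<^sub>m n) * (Q \<otimes>\<^sub>K 1\<^sub>m n) = (A * Q) \<otimes>\<^sub>K (1\<^sub>m n * 1\<^sub>m n)"
    by (rule kron_mult[OF A _ Q(1)]) auto
  also have "\<dots> = 1\<^sub>m (nr * n)" using Q by (simp add: kron_one_one)
  finally have "(A \<otimes>\<^sub>K 1\<^sub>m n) * (Q \<otimes>\<^sub>K 1\<^sub>m n) = 1\<^sub>m (nr * n)" .
  moreover have "Q \<otimes>\<^sub>K 1\<^sub>m n \<in> carrier_mat (nc * n) (nr * n)" using Q(1) by auto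
  moreover have "A \<otimes>\<^sub>K 1\<^sub>m n \<in> carrier_mat (nr * n) (nc * n)" using A by auto
  ultimately show ?thesis by (subst mrank_full_row_iff_right_inverse) blast+
qed

text \<open>If \<open>A v = 0\<close>, then \<open>(A \<otimes> I)(v \<otimes> I) = 0\<close>, and the first column of \<open>v \<otimes> I\<close> is nonzero
  as soon as \<open>v\<close> is, provided that the identity has a column.\<close>
lemma det_kron_one_nonzero_imp:
  fixes A :: "'a::idom mat"
  assumes A: "A \<in> carrier_mat m m" and n: "n \<ge> 1" and det: "det (A \<otimes>\<^sub>K 1\<^sub>m n) \<noteq> 0"
  shows "det A \<noteq> 0"
proof
  assume "det A = 0"
  then obtain v where v: "v \<in> carrier_vec m" "v \<noteq> 0\<^sub>v m" "A *\<^sub>v v = 0\<^sub>v m"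
    using det_0_iff_vec_prod_zero[OF A] by blast
  define V where "V = mat_of_cols m [v]"
  have V: "V \<in> carrier_mat m 1" using mat_of_cols_carrier(1)[of m "[v]"] by (simp add: V_def)
  have AV: "A * V = 0\<^sub>m m 1"
  proof (rule mat_col_eqI)
    fix j assume "j < dim_col (0\<^sub>m m 1 :: 'a mat)"
    then have "j = 0" by simp
    moreover have "col (A * V) 0 = A *\<^sub>v v" using col_mult2[OF A V] v by (simp add: V_def)
    ultimately show "col (A * V) j = col (0\<^sub>m m 1) j" using v by simp
  qed (use A V in auto)
  let ?u = "col (V \<otimes>\<^sub>K 1\<^sub>m n) 0"
  have AI: "A \<otimes>\<^sub>K 1\<^sub>m n \<in> carrier_mat (m * n) (m * n)" and VI: "V \<otimes>\<^sub>K 1\<^sub>m n \<in> carrier_mat (m * n) n"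
    using kron_carrier[OF A one_carrier_mat, of n] kron_carrier[OF V one_carrier_mat, of n] by auto
  have u: "?u \<in> carrier_vec (m * n)" using VI n by (intro col_carrier_vec) auto
  have "(A \<otimes>\<^sub>K 1\<^sub>m n) * (V \<otimes>\<^sub>K 1\<^sub>m n) = (A * V) \<otimes>\<^sub>K (1\<^sub>m n * 1\<^sub>m n)"
    by (rule kron_mult[OF A _ V]) auto
  also have "\<dots> = 0\<^sub>m (m * n) n" by (simp add: AV kron_zero_left)
  finally have "(A \<otimes>\<^sub>K 1\<^sub>m n) *\<^sub>v ?u = 0\<^sub>v (m * n)"
    using col_mult2[OF AI VI, of 0] n by simp
  moreover have "?u \<noteq> 0\<^sub>v (m * n)"
  proof -
    obtain i where i: "i < m" "v $ i \<noteq> 0" using v by (auto simp: vec_eq_iff)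
    have "i * n < m * n" using i n by simp
    then have "?u $ (i * n) = v $ i" using V v n i by (simp add: V_def mat_of_cols_index)
    then show ?thesis using i \<open>i * n < m * n\<close> by (metis index_zero_vec(1))
  qed
  ultimately show False using det det_0_iff_vec_prod_zero[OF AI] u by blast
qed

section \<open>Polynomial matrices as rational matrices\<close>

interpretation to_fract_hom: comm_ring_hom "to_fract :: 'a::idom \<Rightarrow> 'a fract"
  by unfold_locales auto

interpretation poly_hom: comm_ring_hom "\<lambda>p. poly p x" for x :: "'a::comm_ring_1"
  by unfold_locales auto

lemma dim_to_rmat [simp]: "dim_row (to_rmat P) = dim_row P" "dim_col (to_rmat P) = dim_col P"
  by (simp_all add: to_rmat_def)

lemma to_rmat_carrier [simp, intro]: "P \<in> carrier_mat a b \<Longrightarrow> to_rmat P \<in> carrier_mat a b"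
  by (simp add: to_rmat_def)

lemma dim_peval [simp]: "dim_row (peval P x) = dim_row P" "dim_col (peval P x) = dim_col P"
  by (simp_all add: peval_def)

lemma peval_carrier [simp, intro]: "P \<in> carrier_mat a b \<Longrightarrow> peval P x \<in> carrier_mat a b"
  by (simp add: peval_def)

lemma to_rmat_mult:
  "A \<in> carrier_mat a b \<Longrightarrow> B \<in> carrier_mat b c \<Longrightarrow> to_rmat (A * B) = to_rmat A * to_rmat B"
  unfolding to_rmat_def by (rule to_fract_hom.mat_hom_mult)

lemma peval_mult:
  "A \<in> carrier_mat a b \<Longrightarrow> B \<in> carrier_mat b c \<Longrightarrow> peval (A * B) x = peval A x * peval B x"
  unfolding peval_def by (rule poly_hom.mat_hom_mult)

lemma peval_one [simp]: "peval (1\<^sub>m n) x = 1\<^sub>m n"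
  unfolding peval_def by (rule poly_hom.mat_hom_one)

lemma to_rmat_one [simp]: "to_rmat (1\<^sub>m n) = 1\<^sub>m n"
  unfolding to_rmat_def by (rule to_fract_hom.mat_hom_one)

lemma peval_kron_one: "peval (A \<otimes>\<^sub>K 1\<^sub>m n) x = peval A x \<otimes>\<^sub>K 1\<^sub>m n"
  unfolding peval_def poly_hom.mat_hom_kron poly_hom.mat_hom_one ..

lemma to_rmat_kron: "to_rmat (A \<otimes>\<^sub>K B) = to_rmat A \<otimes>\<^sub>K to_rmat B"
  unfolding to_rmat_def by (rule to_fract_hom.mat_hom_kron)

lemma peval_const_pmat [simp]: "peval (const_pmat A) x = A"
  by (rule eq_matI) (auto simp: peval_def const_pmat_def)

lemma const_pmat_carrier [simp, intro]: "A \<in> carrier_mat a b \<Longrightarrow> const_pmat A \<in> carrier_mat a b"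
  by (simp add: const_pmat_def)

lemma pencil_carrier [simp, intro]:
  "A \<in> carrier_mat a b \<Longrightarrow> B \<in> carrier_mat a b \<Longrightarrow> pencil A B \<in> carrier_mat a b"
  unfolding pencil_def by (intro minus_carrier_mat smult_carrier_mat const_pmat_carrier)

lemma reval_to_rmat [simp]: "reval (to_rmat P) x = peval P x"
  by (rule eq_matI) (auto simp: reval_def to_rmat_def peval_def rat_eval_def quot_of_fract_to_fract)

lemma defined_in_to_rmat [simp]: "defined_in \<Omega> (to_rmat P)"
  by (auto simp: defined_in_def rat_defined_at_def to_rmat_def elements_mat_def quot_of_fract_to_fract)

text \<open>A constant right inverse \<open>Q\<close> of \<open>P\<close> at one point makes \<open>P Q\<close> a square polynomial matrix
  whose determinant is \<open>1\<close> there. This determinant is thus not the zero polynomial, and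
  \<open>Q (P Q)\<^sup>-\<^sup>1\<close> is a right inverse of \<open>P\<close> over the rational functions.\<close>
lemma full_row_normal_rank_to_rmatI:
  assumes P: "P \<in> carrier_mat nr nc" and rank: "mrank (peval P x) = nr"
  shows "full_row_normal_rank (to_rmat P)"
proof -
  obtain Q where Q: "Q \<in> carrier_mat nc nr" "peval P x * Q = 1\<^sub>m nr"
    using rank mrank_full_row_iff_right_inverse[OF peval_carrier[OF P]] by blast
  define S where "S = P * const_pmat Q"
  have S: "S \<in> carrier_mat nr nr" using P Q by (simp add: S_def)
  have "poly (det S) x = det (peval S x)"
    unfolding peval_def by (rule poly_hom.hom_det[symmetric])
  also have "peval S x = 1\<^sub>m nr" using P Q by (simp add: S_def peval_mult[of _ nr nc _ nr])
  finally have "det S \<noteq> 0" by auto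
  moreover have "det (to_rmat S) = to_fract (det S)"
    unfolding to_rmat_def by (rule to_fract_hom.hom_det)
  ultimately have "det (to_rmat S) \<noteq> 0" by simp
  note inv = inv_mat_inverse[OF to_rmat_carrier[OF S] this]
  have "to_rmat P * (to_rmat (const_pmat Q) * inv_mat (to_rmat S)) =
    to_rmat P * to_rmat (const_pmat Q) * inv_mat (to_rmat S)"
    by (rule assoc_mult_mat[symmetric]) (use P Q inv(1) in auto)
  also have "to_rmat P * to_rmat (const_pmat Q) = to_rmat S"
    unfolding S_def by (rule to_rmat_mult[symmetric]) (use P Q in auto)
  also have "to_rmat S * inv_mat (to_rmat S) = 1\<^sub>m nr" by (rule inv(2))
  finally have "mrank (to_rmat P) = nr"
    using mrank_full_row_iff_right_inverse[OF to_rmat_carrier[OF P]] Q inv(1)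
    by (auto intro!: bexI[of _ "to_rmat (const_pmat Q) * inv_mat (to_rmat S)"] mult_carrier_mat)
  then show ?thesis using P by (simp add: full_row_normal_rank_def)
qed

lemma full_row_rank_in_to_rmatI:
  assumes "\<And>x. mrank (peval P x) = dim_row P"
  shows "full_row_rank_in \<Omega> (to_rmat P)"
  using assms by (simp add: full_row_rank_in_def)

lemma to_rmat_smult: "to_rmat (p \<cdot>\<^sub>m A) = to_fract p \<cdot>\<^sub>m to_rmat A"
  by (rule eq_matI) (auto simp: to_rmat_def)

lemma to_rmat_uminus: "to_rmat (- A) = - to_rmat A"
  by (rule eq_matI) (auto simp: to_rmat_def to_fract_hom.hom_uminus)

section \<open>Pencils\<close>

lemma is_pencil_iff: "is_pencil P \<longleftrightarrow> (\<forall>i<dim_row P. \<forall>j<dim_col P. degree (P $$ (i, j)) \<le> 1)"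
  by (auto simp: is_pencil_def elements_mat_def)

lemma is_pencil_pencil:
  assumes "dim_row B = dim_row A" "dim_col B = dim_col A"
  shows "is_pencil (pencil A B)"
  using assms unfolding is_pencil_iff
  by (auto simp: pencil_def const_pmat_def intro!: degree_diff_le)

text \<open>Degrees add up under the Kronecker product, so a pencil may only meet a constant factor.\<close>
lemma is_pencil_kron:
  assumes "\<And>i j. i < dim_row A \<Longrightarrow> j < dim_col A \<Longrightarrow> degree (A $$ (i, j)) \<le> a"
    and "\<And>i j. i < dim_row B \<Longrightarrow> j < dim_col B \<Longrightarrow> degree (B $$ (i, j)) \<le> b"
    and "a + b \<le> 1"
  shows "is_pencil (A \<otimes>\<^sub>K B)"
  unfolding is_pencil_iff
proof (intro allI impI)
  fix i j assume "i < dim_row (A \<otimes>\<^sub>K B)" "j < dim_col (A \<otimes>\<^sub>K B)"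
  then have i: "i < dim_row A * dim_row B" and j: "j < dim_col A * dim_col B" by auto
  have "degree ((A \<otimes>\<^sub>K B) $$ (i, j)) \<le> a + b"
    using i j assms kron_index_bounds[OF i] kron_index_bounds[OF j]
    by (auto intro!: order.trans[OF degree_mult_le] add_mono)
  then show "degree ((A \<otimes>\<^sub>K B) $$ (i, j)) \<le> 1" using assms(3) by linarith
qed

lemma is_pencil_append_rows:
  assumes "is_pencil A" "is_pencil B" "dim_col B = dim_col A"
  shows "is_pencil (A @\<^sub>r B)"
  using assms unfolding is_pencil_iff by auto

lemma is_pencil_append_cols:
  assumes "is_pencil A" "is_pencil B" "dim_row B = dim_row A"
  shows "is_pencil (A @\<^sub>c B)"
  using assms unfolding is_pencil_iff by auto

lemma is_pencil_zero [simp]: "is_pencil (0\<^sub>m a b)"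
  by (simp add: is_pencil_iff)

lemma is_pencil_row_blocks:
  assumes "\<And>A. A \<in> set As \<Longrightarrow> is_pencil A \<and> dim_row A = nr"
  shows "is_pencil (row_blocks nr As)"
  using assms
proof (induction As)
  case (Cons A As)
  then show ?case using row_blocks_carrier[of As nr] by (auto intro!: is_pencil_append_cols)
qed simp

lemma is_pencil_diag_block_mat:
  assumes "\<And>A. A \<in> set As \<Longrightarrow> is_pencil A"
  shows "is_pencil (diag_block_mat As)"
  using assms elements_diag_block_mat[of As] unfolding is_pencil_def by fastforce

lemma is_pencil_four_block_mat:
  assumes "is_pencil A" "is_pencil B" "is_pencil C" "is_pencil D"
    and "B \<in> carrier_mat (dim_row A) (dim_col D)" "C \<in> carrier_mat (dim_row D) (dim_col A)"
  shows "is_pencil (four_block_mat A B C D)"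
  using assms unfolding is_pencil_iff by auto

lemma is_pencil_EF_pencil: "is_pencil (EF_pencil l z w)"
  by (auto simp: is_pencil_iff EF_pencil_def)

section \<open>Linearizations with an empty second basis\<close>

text \<open>Here \<open>F\<close> is the transpose of the basis dual to \<open>K\<close>, and \<open>U\<close> is a polynomial left inverse of
  \<open>F\<close> through which the lower left block \<open>B\<^sub>0 U\<close> factors. Then \<open>(B\<^sub>0 U) F = B\<^sub>0\<close>, so
  compressing this block with \<open>F\<close> loses no rank. The blocks of the linearization are \<open>C = - Q\<close>
  and \<open>B = B\<^sub>0 U\<close>, which is why the second summand of the transfer function carries \<open>- B\<^sub>0\<close>.\<close>
lemma one_sided_block_full_rank_linearization:
  fixes M K Q B0 U F St :: pmat
  defines "L \<equiv> four_block_mat (M @\<^sub>r K) (Q @\<^sub>r 0\<^sub>m (dim_row K) (dim_row St)) (B0 * U) St"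
  assumes M: "M \<in> carrier_mat n c" and K: "K \<in> carrier_mat r c" and nr: "n + r = c"
    and Q: "Q \<in> carrier_mat n N" and B0: "B0 \<in> carrier_mat N n"
    and U: "U \<in> carrier_mat n c" and F: "F \<in> carrier_mat c n"
    and St: "St \<in> carrier_mat N N" and N_pos: "N > 0"
    and UF: "U * F = 1\<^sub>m n" and KF: "K * F = 0\<^sub>m r n"
    and rank_K: "\<And>x. mrank (peval K x) = r"
    and pencil_K: "is_pencil K" and pencil_L: "is_pencil L" and nonconst: "nonconstant L"
    and minimal: "minimal_in \<Omega> L St"
  shows "block_full_rank_linearization \<Omega> L
    (to_rmat M * to_rmat F + to_rmat Q * inv_mat (to_rmat St) * to_rmat (- B0)) St"
proof -
  define Bm where "Bm = B0 * U"
  have Bm: "Bm \<in> carrier_mat N c" using B0 U by (simp add: Bm_def)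
  have BmF: "Bm * F = B0"
    using assoc_mult_mat[OF B0 U F] UF B0 by (simp add: Bm_def)
  have L_eq: "L = four_block_mat (M @\<^sub>r K) (Q @\<^sub>r 0\<^sub>m r N) Bm St"
    using K St by (simp add: L_def Bm_def)

  obtain D1 C1 B1 where sys: "system_matrix L D1 C1 B1 St"
    and min: "\<And>x. x \<in> \<Omega> \<Longrightarrow> mrank (peval St x @\<^sub>r peval C1 x) = N \<and> mrank (peval St x @\<^sub>c peval B1 x) = N"
    using minimal St unfolding minimal_in_def by auto
  have reg: "regular St" using sys by (simp add: system_matrix_def)
  have D1: "D1 \<in> carrier_mat c c"
  proof (rule carrier_matI)
    have eq: "four_block_mat (M @\<^sub>r K) (Q @\<^sub>r 0\<^sub>m r N) Bm St = four_block_mat D1 (- C1) B1 St"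
      using sys by (simp add: system_matrix_def L_eq)
    show "dim_row D1 = c" using arg_cong[OF eq, of dim_row] M K nr by simp
    show "dim_col D1 = c" using arg_cong[OF eq, of dim_col] M K nr by simp
  qed
  have C1: "C1 \<in> carrier_mat c N" and B1: "B1 \<in> carrier_mat N c"
    and L1: "four_block_mat (M @\<^sub>r K) (Q @\<^sub>r 0\<^sub>m r N) Bm St = four_block_mat D1 (- C1) B1 St"
    using sys D1 St by (auto simp: system_matrix_def L_eq)
  have MK: "M @\<^sub>r K \<in> carrier_mat c c" and Q0: "Q @\<^sub>r 0\<^sub>m r N \<in> carrier_mat c N"
    using carrier_append_rows[OF M K] carrier_append_rows[OF Q zero_carrier_mat[of r N]] nr by simp_all
  have "Q @\<^sub>r 0\<^sub>m r N = - C1" and B1_eq: "B1 = Bm"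
    using four_block_mat_off_diagonal_inj[OF L1 MK _ _ D1] Q0 Bm C1 B1 St by auto
  then have C1_eq: "C1 = - (Q @\<^sub>r 0\<^sub>m r N)" by simp

  define Cm where "Cm = - Q"
  have Cm: "Cm \<in> carrier_mat n N" using Q by (simp add: Cm_def)
  \<comment> \<open>An empty \<open>K2\<close> still has \<open>n\<close> columns; they fix the size of its dual, the identity.\<close>
  define K2 where "K2 = (0\<^sub>m 0 n :: pmat)"
  have K2: "K2 \<in> carrier_mat 0 n" by (simp add: K2_def)
  have C1_Cm: "C1 = Cm @\<^sub>r 0\<^sub>m r N"
    unfolding C1_eq Cm_def by (rule eq_matI) (use Q in auto)

  have sysL: "system_matrix L
      (four_block_mat M (transpose_mat K2) K (0\<^sub>m (dim_row K) (dim_row K2)))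
      (Cm @\<^sub>r 0\<^sub>m (dim_row K) (dim_row St)) (Bm @\<^sub>c 0\<^sub>m (dim_row St) (dim_row K2)) St"
  proof -
    have 1: "four_block_mat M (transpose_mat K2) K (0\<^sub>m (dim_row K) (dim_row K2)) = M @\<^sub>r K"
      using M K by (simp add: append_rows_def K2_def)
    have 2: "Cm @\<^sub>r 0\<^sub>m (dim_row K) (dim_row St) = C1" using K St by (simp add: C1_Cm)
    have 3: "Bm @\<^sub>c 0\<^sub>m (dim_row St) (dim_row K2) = B1"
      unfolding B1_eq by (rule eq_matI) (use Bm St in \<open>auto simp: K2_def\<close>)
    have "- C1 = Q @\<^sub>r 0\<^sub>m r N" by (simp add: C1_eq)
    then have "system_matrix L (M @\<^sub>r K) C1 B1 St"
      unfolding system_matrix_def L_eq using reg C1 B1 MK St M K nr by (auto simp: B1_eq)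
    then show ?thesis unfolding 1 2 3 .
  qed

  define N1 where "N1 = to_rmat (transpose_mat F)"
  define N2 where "N2 = to_rmat (1\<^sub>m n)"
  have FT: "transpose_mat F \<in> carrier_mat n c" and UT: "transpose_mat U \<in> carrier_mat c n"
    using F U by simp_all
  have N1T: "transpose_mat N1 = to_rmat F"
    by (rule eq_matI) (auto simp: N1_def to_rmat_def)
  have rank_FT: "mrank (peval (transpose_mat F) x) = n" for x
  proof -
    have "peval (transpose_mat F) x * peval (transpose_mat U) x = peval (transpose_mat (U * F)) x"
      using peval_mult[OF FT UT] transpose_mult[OF U F] by simp
    also have "\<dots> = 1\<^sub>m n" by (simp add: UF)
    finally show ?thesis
      using mrank_full_row_iff_right_inverse[OF peval_carrier[OF FT]] peval_carrier[OF UT] by blast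
  qed
  have rank_K2: "mrank (peval K2 x) = 0" for x
  proof -
    have "peval K2 x * 0\<^sub>m n 0 = 1\<^sub>m 0" by (rule eq_matI) (auto simp: K2_def)
    then show ?thesis
      using mrank_full_row_iff_right_inverse[OF peval_carrier[OF K2]] zero_carrier_mat by blast
  qed
  have rank_1: "mrank (peval (1\<^sub>m n) x) = n" for x
    using mrank_full_row_iff_right_inverse[OF one_carrier_mat[of n]] right_mult_one_mat[OF one_carrier_mat[of n]]
    by (metis one_carrier_mat peval_one)
  have normal: "full_row_normal_rank (to_rmat K)" "full_row_normal_rank N1"
    "full_row_normal_rank (to_rmat K2)" "full_row_normal_rank N2"
    unfolding N1_def N2_def
    using full_row_normal_rank_to_rmatI[OF K rank_K] full_row_normal_rank_to_rmatI[OF FT rank_FT]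
      full_row_normal_rank_to_rmatI[OF K2 rank_K2] full_row_normal_rank_to_rmatI[OF one_carrier_mat rank_1]
    by auto
  have full: "full_row_rank_in \<Omega> (to_rmat K)" "full_row_rank_in \<Omega> N1"
    "full_row_rank_in \<Omega> (to_rmat K2)" "full_row_rank_in \<Omega> N2"
    unfolding N1_def N2_def
    using full_row_rank_in_to_rmatI[of K] rank_K K full_row_rank_in_to_rmatI[of "transpose_mat F"] rank_FT FT
      full_row_rank_in_to_rmatI[of K2] rank_K2 K2 full_row_rank_in_to_rmatI[of "1\<^sub>m n"] rank_1
    by auto
  have dual1: "dual_rational_bases (to_rmat K) N1"
  proof -
    have "to_rmat K * transpose_mat N1 = to_rmat (K * F)"
      unfolding N1T by (rule to_rmat_mult[OF K F, symmetric])
    also have "\<dots> = 0\<^sub>m r n" unfolding KF by (rule eq_matI) (auto simp: to_rmat_def)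
    finally show ?thesis
      using normal K FT nr by (simp add: dual_rational_bases_def N1_def add.commute)
  qed
  have dual2: "dual_rational_bases (to_rmat K2) N2"
    using normal K2 by (auto simp: dual_rational_bases_def N2_def intro!: eq_matI)

  \<comment> \<open>With \<open>N2\<close> the identity, only the zero rows below \<open>Cm\<close> have to be dropped.\<close>
  have rank_obs: "mrank (peval St x @\<^sub>r (- (reval N2 x * peval Cm x))) = dim_row St" if x: "x \<in> \<Omega>" for x
  proof -
    have Cx: "peval Cm x \<in> carrier_mat n N" using Cm by auto
    have "peval C1 x = peval Cm x @\<^sub>r 0\<^sub>m r N"
      unfolding C1_Cm by (rule eq_matI) (use Cm in \<open>auto simp: peval_def\<close>)
    also have "\<dots> = (- (1\<^sub>m n @\<^sub>r 0\<^sub>m r n)) * (- peval Cm x)" by (rule append_rows_zero_eq[OF Cx])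
    finally have "mrank (peval St x @\<^sub>r ((- (1\<^sub>m n @\<^sub>r 0\<^sub>m r n)) * (- peval Cm x))) = N"
      using min[OF x] by simp
    moreover have "- (1\<^sub>m n @\<^sub>r 0\<^sub>m r n) \<in> carrier_mat (n + r) n"
      by (simp only: uminus_carrier_iff_mat) (rule carrier_append_rows; simp)
    ultimately have "mrank (peval St x @\<^sub>r (- peval Cm x)) = N"
      using mrank_append_rows_factor[OF peval_carrier[OF St]] Cx uminus_carrier_mat by blast
    moreover have "reval N2 x * peval Cm x = peval Cm x"
      unfolding N2_def reval_to_rmat peval_one by (rule left_mult_one_mat[OF Cx])
    ultimately show ?thesis using St by simp
  qed
  \<comment> \<open>Compression with \<open>F\<close> cancels the factor \<open>U\<close> of \<open>Bm = B0 * U\<close>.\<close>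
  have rank_ctrl: "mrank (peval St x @\<^sub>c (peval Bm x * transpose_mat (reval N1 x))) = dim_row St" if x: "x \<in> \<Omega>" for x
  proof -
    have "transpose_mat (reval N1 x) = peval F x"
      unfolding N1_def reval_to_rmat by (rule eq_matI) (auto simp: peval_def)
    then have "peval Bm x * transpose_mat (reval N1 x) = peval B0 x"
      using peval_mult[OF Bm F, of x] BmF by simp
    moreover have "mrank (peval St x @\<^sub>c (peval B0 x * peval U x)) = N"
      using min[OF x] peval_mult[OF B0 U, of x] by (simp add: B1_eq Bm_def)
    then have "mrank (peval St x @\<^sub>c peval B0 x) = N"
      by (rule mrank_append_cols_factor[OF peval_carrier[OF St] peval_carrier[OF B0] peval_carrier[OF U]])
    ultimately show ?thesis using St by simp
  qed

  have R: "to_rmat M * to_rmat F + to_rmat Q * inv_mat (to_rmat St) * to_rmat (- B0) =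
      N2 * (to_rmat M + to_rmat Cm * inv_mat (to_rmat St) * to_rmat Bm) * transpose_mat N1"
  proof -
    have "det (to_rmat St) \<noteq> 0"
      using reg by (simp add: regular_def to_rmat_def to_fract_hom.hom_det)
    note inv = inv_mat_inverse(1)[OF to_rmat_carrier[OF St] this]
    let ?S = "inv_mat (to_rmat St)"
    have QS: "to_rmat Q * ?S \<in> carrier_mat n N" using Q inv by (intro mult_carrier_mat) auto
    have CS: "to_rmat Cm * ?S \<in> carrier_mat n N" using Cm inv by (intro mult_carrier_mat) auto
    have CSB: "to_rmat Cm * ?S * to_rmat Bm \<in> carrier_mat n c" by (rule mult_carrier_mat[OF CS to_rmat_carrier[OF Bm]])
    have "N2 * (to_rmat M + to_rmat Cm * ?S * to_rmat Bm) * transpose_mat N1 =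
        (to_rmat M + to_rmat Cm * ?S * to_rmat Bm) * to_rmat F"
      unfolding N1T N2_def to_rmat_one
      by (subst left_mult_one_mat[OF add_carrier_mat[OF CSB]]) (rule refl)
    also have "\<dots> = to_rmat M * to_rmat F + to_rmat Cm * ?S * to_rmat Bm * to_rmat F"
      by (rule add_mult_distrib_mat[OF to_rmat_carrier[OF M] CSB to_rmat_carrier[OF F]])
    also have "to_rmat Cm * ?S * to_rmat Bm * to_rmat F = to_rmat Cm * ?S * (to_rmat Bm * to_rmat F)"
      by (rule assoc_mult_mat[OF CS to_rmat_carrier[OF Bm] to_rmat_carrier[OF F]])
    also have "to_rmat Bm * to_rmat F = to_rmat B0" using to_rmat_mult[OF Bm F] BmF by simp
    also have "to_rmat Cm * ?S * to_rmat B0 = to_rmat Q * ?S * to_rmat (- B0)"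
      using Q inv B0 QS by (simp add: Cm_def to_rmat_uminus uminus_mult_left_mat uminus_mult_right_mat)
    finally show ?thesis by simp
  qed

  have "(\<forall>x\<in>\<Omega>. mrank (peval St x @\<^sub>r (- (reval N2 x * peval Cm x))) = dim_row St \<and>
      mrank (peval St x @\<^sub>c (peval Bm x * transpose_mat (reval N1 x))) = dim_row St)"
    using rank_obs rank_ctrl by blast
  moreover have "M \<in> carrier_mat (dim_col K2) (dim_col K)" "Bm \<in> carrier_mat (dim_row St) (dim_col K)"
    "Cm \<in> carrier_mat (dim_col K2) (dim_row St)" "is_pencil K2" "dim_row St > 0"
    using M K Bm Cm St N_pos by (simp_all add: K2_def)
  ultimately show ?thesis
    unfolding block_full_rank_linearization_def
    using sysL pencil_K pencil_L nonconst normal full dual1 dual2 R by blast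
qed

section \<open>The two summands of the rational matrix\<close>

text \<open>The factor through which the block \<open>[- b \<otimes> I\<^sub>n, 0]\<close> passes.\<close>
lemma kron_unit_row:
  assumes "k \<ge> 1"
  shows "mat 1 k (\<lambda>(_, j). if j = 0 then 1 else 0) \<otimes>\<^sub>K 1\<^sub>m n =
    (1\<^sub>m n @\<^sub>c 0\<^sub>m n ((k - 1) * n) :: 'a::comm_semiring_1 mat)"
proof (rule eq_matI)
  have kn: "n + (k - 1) * n = k * n" using assms by (cases k) auto
  fix i j assume "i < dim_row (1\<^sub>m n @\<^sub>c 0\<^sub>m n ((k - 1) * n) :: 'a mat)"
    "j < dim_col (1\<^sub>m n @\<^sub>c 0\<^sub>m n ((k - 1) * n) :: 'a mat)"
  then have i: "i < n" and j: "j < k * n" using kn by auto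
  have "j div n = 0 \<longleftrightarrow> j < n" using i by (auto simp: div_eq_0_iff)
  then show "(mat 1 k (\<lambda>(_, j). if j = 0 then 1 else 0) \<otimes>\<^sub>K 1\<^sub>m n) $$ (i, j) =
      (1\<^sub>m n @\<^sub>c 0\<^sub>m n ((k - 1) * n) :: 'a mat) $$ (i, j)"
    using i j kn kron_index_bounds[OF j] by auto
qed (use assms in \<open>cases k; auto\<close>)+

text \<open>The column \<open>f \<otimes> I\<^sub>n\<close> is the stack of the blocks \<open>f\<^sub>i I\<^sub>n\<close>, so the product is a sum of
  products of blocks.\<close>
lemma row_blocks_mult_kron_col:
  fixes P :: "nat \<Rightarrow> 'a::comm_semiring_1 mat"
  assumes P: "\<And>i. i < k \<Longrightarrow> P i \<in> carrier_mat n n"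
  shows "row_blocks n (map P [0..<k]) * (mat k 1 (\<lambda>(i, _). f i) \<otimes>\<^sub>K 1\<^sub>m n) =
    mat_sum n n {..<k} (\<lambda>i. f i \<cdot>\<^sub>m P i)"
proof -
  have "mat k 1 (\<lambda>(i, _). f i) = mat (length (map f [0..<k])) 1 (\<lambda>(i, _). map f [0..<k] ! i)"
    by (rule eq_matI) auto
  also have "\<dots> = col_blocks 1 (map (\<lambda>i. mat 1 1 (\<lambda>_. f i)) [0..<k])"
    unfolding col_mat_eq_col_blocks by (simp add: comp_def)
  finally have F: "mat k 1 (\<lambda>(i, _). f i) = col_blocks 1 (map (\<lambda>i. mat 1 1 (\<lambda>_. f i)) [0..<k])" .
  have "mat k 1 (\<lambda>(i, _). f i) \<otimes>\<^sub>K 1\<^sub>m n = col_blocks (1 * dim_col (1\<^sub>m n :: 'a mat))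
      (map (\<lambda>A. A \<otimes>\<^sub>K 1\<^sub>m n) (map (\<lambda>i. mat 1 1 (\<lambda>_. f i)) [0..<k]))"
    unfolding F by (rule kron_col_blocks) auto
  also have "\<dots> =
      col_blocks n (map (\<lambda>i. mat 1 1 (\<lambda>_. f i) \<otimes>\<^sub>K 1\<^sub>m n) [0..<k])"
    by (simp add: comp_def)
  also have "map (\<lambda>i. mat 1 1 (\<lambda>_. f i) \<otimes>\<^sub>K 1\<^sub>m n) [0..<k] = map (\<lambda>i. f i \<cdot>\<^sub>m 1\<^sub>m n) [0..<k]"
    by (simp add: kron_1x1_left)
  finally have "row_blocks n (map P [0..<k]) * (mat k 1 (\<lambda>(i, _). f i) \<otimes>\<^sub>K 1\<^sub>m n) =
      row_blocks n (map P [0..<k]) * col_blocks n (map (\<lambda>i. f i \<cdot>\<^sub>m 1\<^sub>m n) [0..<k])"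
    by simp
  also have "\<dots> = mat_sum n n (set [0..<k]) (\<lambda>i. P i * (f i \<cdot>\<^sub>m 1\<^sub>m n))"
    by (rule row_blocks_mult_col_blocks[where m = "\<lambda>_. n"]) (use P in auto)
  also have "\<dots> = mat_sum n n {..<k} (\<lambda>i. f i \<cdot>\<^sub>m P i)"
    unfolding atLeast_upt[symmetric]
  proof (rule mat_sum_cong)
    fix i assume "i \<in> {..<k}"
    then have Pi: "P i \<in> carrier_mat n n" using P by simp
    have "P i * (f i \<cdot>\<^sub>m 1\<^sub>m n) = f i \<cdot>\<^sub>m (P i * 1\<^sub>m n)"
      by (rule mult_smult_distrib[OF Pi]) auto
    then show "P i * (f i \<cdot>\<^sub>m 1\<^sub>m n) = f i \<cdot>\<^sub>m P i" using Pi by simp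
  qed
  finally show ?thesis .
qed

text \<open>Each block \<open>E\<^sub>i\<close> has its own inverse, and the columns \<open>E\<^sub>i\<^sup>-\<^sup>1 b\<^sub>i\<close> stack up to the
  column \<open>v\<close> with \<open>(diag(E\<^sub>i) \<otimes> I) (v \<otimes> I) = b \<otimes> I\<close>; uniqueness of the solution identifies
  \<open>v \<otimes> I\<close> with the inverse applied to \<open>b \<otimes> I\<close>.\<close>
lemma block_diagonal_transfer_function:
  fixes E :: "'i \<Rightarrow> 'a::field mat"
  assumes dist: "distinct is"
    and E: "\<And>i. i \<in> set is \<Longrightarrow> E i \<in> carrier_mat (m i) (m i)"
    and det: "\<And>i. i \<in> set is \<Longrightarrow> det (E i) \<noteq> 0"
    and a: "\<And>i. i \<in> set is \<Longrightarrow> a i \<in> carrier_mat 1 (m i)"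
    and b: "\<And>i. i \<in> set is \<Longrightarrow> b i \<in> carrier_mat (m i) 1"
    and P: "\<And>i. i \<in> set is \<Longrightarrow> P i \<in> carrier_mat n n"
    and det_S: "det (diag_block_mat (map E is) \<otimes>\<^sub>K 1\<^sub>m n) \<noteq> 0"
  shows "row_blocks n (map (\<lambda>i. a i \<otimes>\<^sub>K P i) is) * inv_mat (diag_block_mat (map E is) \<otimes>\<^sub>K 1\<^sub>m n) *
      (col_blocks 1 (map b is) \<otimes>\<^sub>K 1\<^sub>m n) =
    mat_sum n n (set is) (\<lambda>i. (a i * inv_mat (E i) * b i) $$ (0, 0) \<cdot>\<^sub>m P i)"
proof -
  let ?N = "sum_list (map m is)"
  let ?S = "diag_block_mat (map E is) \<otimes>\<^sub>K 1\<^sub>m n"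
  let ?c = "row_blocks n (map (\<lambda>i. a i \<otimes>\<^sub>K P i) is)"
  let ?b = "col_blocks 1 (map b is)"
  define v where "v i = inv_mat (E i) * b i" for i
  note inv = inv_mat_inverse[OF E det]
  have v: "v i \<in> carrier_mat (m i) 1" if "i \<in> set is" for i
    using inv(1)[OF that that] b[OF that] by (simp add: v_def)
  let ?v = "col_blocks 1 (map v is)"
  have Ev: "E i * v i = b i" if "i \<in> set is" for i
    using assoc_mult_mat[OF E[OF that] inv(1)[OF that that] b[OF that]] inv(2)[OF that that] b[OF that]
    by (simp add: v_def)
  have D: "diag_block_mat (map E is) \<in> carrier_mat ?N ?N"
    by (rule diag_block_mat_map_carrier[OF E])
  have vc: "?v \<in> carrier_mat ?N 1" by (rule col_blocks_map_carrier[OF v])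
  have S: "?S \<in> carrier_mat (?N * n) (?N * n)" using D by auto
  have vI: "?v \<otimes>\<^sub>K 1\<^sub>m n \<in> carrier_mat (?N * n) n" using kron_carrier[OF vc one_carrier_mat[of n]] by simp
  have "?c \<in> carrier_mat n (sum_list (map (\<lambda>i. m i * n) is))"
    by (rule row_blocks_map_carrier) (use kron_carrier[OF a P] in auto)
  then have c: "?c \<in> carrier_mat n (?N * n)" by (simp add: sum_list_mult_const)
  have "?S * (?v \<otimes>\<^sub>K 1\<^sub>m n) = (diag_block_mat (map E is) * ?v) \<otimes>\<^sub>K (1\<^sub>m n * 1\<^sub>m n)"
    by (rule kron_mult[OF D _ vc]) auto
  also have "diag_block_mat (map E is) * ?v = col_blocks 1 (map (\<lambda>i. E i * v i) is)"
    by (rule diag_block_mat_mult_col_blocks[OF E v])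
  also have "map (\<lambda>i. E i * v i) is = map b is" using Ev by simp
  finally have Sv: "?S * (?v \<otimes>\<^sub>K 1\<^sub>m n) = ?b \<otimes>\<^sub>K 1\<^sub>m n" by simp
  note invS = inv_mat_inverse[OF S det_S]
  have bI: "?b \<otimes>\<^sub>K 1\<^sub>m n \<in> carrier_mat (?N * n) n" using Sv mult_carrier_mat[OF S vI] by simp
  have "?c * inv_mat ?S * (?b \<otimes>\<^sub>K 1\<^sub>m n) = ?c * (inv_mat ?S * (?S * (?v \<otimes>\<^sub>K 1\<^sub>m n)))"
    unfolding Sv by (rule assoc_mult_mat[OF c invS(1) bI])
  also have "inv_mat ?S * (?S * (?v \<otimes>\<^sub>K 1\<^sub>m n)) = inv_mat ?S * ?S * (?v \<otimes>\<^sub>K 1\<^sub>m n)"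
    by (rule assoc_mult_mat[OF invS(1) S vI, symmetric])
  also have "\<dots> = ?v \<otimes>\<^sub>K 1\<^sub>m n" unfolding invS(3) by (rule left_mult_one_mat[OF vI])
  also have "?v \<otimes>\<^sub>K 1\<^sub>m n = col_blocks (1 * dim_col (1\<^sub>m n :: 'a mat)) (map (\<lambda>A. A \<otimes>\<^sub>K 1\<^sub>m n) (map v is))"
    by (rule kron_col_blocks) (use v in auto)
  also have "\<dots> = col_blocks n (map (\<lambda>i. v i \<otimes>\<^sub>K 1\<^sub>m n) is)" by (simp add: comp_def)
  also have "?c * \<dots> = mat_sum n n (set is) (\<lambda>i. (a i \<otimes>\<^sub>K P i) * (v i \<otimes>\<^sub>K 1\<^sub>m n))"
  proof (rule row_blocks_mult_col_blocks[OF dist])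
    fix i assume i: "i \<in> set is"
    show "a i \<otimes>\<^sub>K P i \<in> carrier_mat n (m i * n)" using kron_carrier[OF a[OF i] P[OF i]] by simp
    show "v i \<otimes>\<^sub>K 1\<^sub>m n \<in> carrier_mat (m i * n) n" using kron_carrier[OF v[OF i] one_carrier_mat[of n]] by simp
  qed
  also have "\<dots> = mat_sum n n (set is) (\<lambda>i. (a i * inv_mat (E i) * b i) $$ (0, 0) \<cdot>\<^sub>m P i)"
  proof (rule mat_sum_cong)
    fix i assume i: "i \<in> set is"
    have "(a i \<otimes>\<^sub>K P i) * (v i \<otimes>\<^sub>K 1\<^sub>m n) = (a i * v i) \<otimes>\<^sub>K (P i * 1\<^sub>m n)"
      by (rule kron_mult[OF a[OF i] P[OF i] v[OF i]]) auto
    also have "\<dots> = (a i * v i) $$ (0, 0) \<cdot>\<^sub>m P i"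
      using P[OF i] mult_carrier_mat[OF a[OF i] v[OF i]] by (simp add: kron_1x1_left)
    also have "a i * v i = a i * inv_mat (E i) * b i"
      unfolding v_def by (rule assoc_mult_mat[OF a[OF i] inv(1)[OF i i] b[OF i], symmetric])
    finally show "(a i \<otimes>\<^sub>K P i) * (v i \<otimes>\<^sub>K 1\<^sub>m n) = (a i * inv_mat (E i) * b i) $$ (0, 0) \<cdot>\<^sub>m P i" .
  qed
  finally show ?thesis .
qed

section \<open>The linearization built from barycentric data\<close>

lemma EF_pencil_carrier [simp, intro]: "EF_pencil l z w \<in> carrier_mat l l"
  by (simp add: EF_pencil_def)

lemma a_col_carrier [simp, intro]: "a_col l g z w \<in> carrier_mat l 1"
  by (simp add: a_col_def)

lemma b_col_carrier [simp, intro]: "b_col l \<in> carrier_mat l 1"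
  by (simp add: b_col_def)

text \<open>The determinant of a block diagonal matrix is the product of the determinants of the blocks,
  so a regular state matrix forces every block to be regular. This is what makes \<open>inv_mat\<close> in
  \<open>R_mat\<close> a genuine inverse.\<close>
lemma nonzero_det_EF_pencil:
  assumes n: "n \<ge> 1" and reg: "regular (state_mat n s l z w)" and i: "i \<in> {1..s}"
  shows "det (EF_pencil (l i) (z i) (w i)) \<noteq> 0"
proof -
  have sq: "square_mat A" if "A \<in> set (map (\<lambda>i. EF_pencil (l i) (z i) (w i)) [1..<Suc s])" for A
    using that by (auto simp: EF_pencil_def)
  have "square_mat (EF_diag s l z w)"
    unfolding EF_diag_def by (rule diag_block_mat_square) (use sq in blast)
  then have D: "EF_diag s l z w \<in> carrier_mat (dim_row (EF_diag s l z w)) (dim_row (EF_diag s l z w))"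
    by (intro carrier_matI) auto
  have "det (EF_diag s l z w) \<noteq> 0"
    by (rule det_kron_one_nonzero_imp[OF D n]) (use reg in \<open>simp add: regular_def state_mat_def\<close>)
  also have "det (EF_diag s l z w) = prod_list (map det (map (\<lambda>i. EF_pencil (l i) (z i) (w i)) [1..<Suc s]))"
    unfolding EF_diag_def by (rule det_diag_block_mat[OF sq])
  finally show ?thesis using i by (auto simp: prod_list_zero_iff image_iff)
qed

text \<open>\<open>b_stack\<close> is defined as the transpose of a row; as a column of blocks it can be multiplied
  by the block diagonal state matrix.\<close>
lemma const_b_stack:
  "const_pmat (b_stack s l) = col_blocks 1 (map (\<lambda>i. const_pmat (b_col (l i))) [1..<Suc s])"
proof -
  have dims: "dim_col Z = 1" if "Z \<in> set (map (\<lambda>i. b_col (l i)) [1..<Suc s])" for Z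
    using that by (auto simp: b_col_def)
  have "b_stack s l = col_blocks 1 (map transpose_mat (map (\<lambda>i. transpose_mat (b_col (l i))) [1..<Suc s]))"
    unfolding b_stack_def by (rule transpose_row_blocks) (auto simp: b_col_def)
  also have "map transpose_mat (map (\<lambda>i. transpose_mat (b_col (l i))) [1..<Suc s]) = map (\<lambda>i. b_col (l i)) [1..<Suc s]"
    by simp
  finally have eq: "b_stack s l = col_blocks 1 (map (\<lambda>i. b_col (l i)) [1..<Suc s])" .
  have "const_pmat (b_stack s l) = col_blocks 1 (map (map_mat (\<lambda>c. [:c:])) (map (\<lambda>i. b_col (l i)) [1..<Suc s]))"
    unfolding const_pmat_def eq by (rule map_mat_col_blocks) (rule dims)
  then show ?thesis by (simp add: const_pmat_def comp_def del: upt_Suc)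
qed

theorem theorem4p6:
  fixes n k s :: nat
    and A B C D :: "nat \<Rightarrow> complex mat"
    and X Y :: "complex mat"
    and f :: "nat \<Rightarrow> complex poly"
    and l :: "nat \<Rightarrow> nat"
    and g :: "nat \<Rightarrow> complex \<Rightarrow> complex"
    and z w :: "nat \<Rightarrow> nat \<Rightarrow> complex"
    and \<Omega> :: "complex set"
  assumes n: "n \<ge> 1" and k: "k \<ge> 1" and s: "s \<ge> 1"
    and AB: "\<And>i. i < k \<Longrightarrow> A i \<in> carrier_mat n n \<and> B i \<in> carrier_mat n n"
    and CD: "\<And>i. i \<in> {1..s} \<Longrightarrow> C i \<in> carrier_mat n n \<and> D i \<in> carrier_mat n n"
    and XY: "X \<in> carrier_mat (k - 1) k" "Y \<in> carrier_mat (k - 1) k"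
    and XY_rank: "\<And>x. mrank (peval (pencil X Y) x) = k - 1"
    and f0: "f 0 = 1"
    and f_rel: "pencil X Y *\<^sub>v vec k f = 0\<^sub>v (k - 1)"
    and l: "\<And>i. i \<in> {1..s} \<Longrightarrow> l i \<ge> 1"
    and z: "\<And>i. i \<in> {1..s} \<Longrightarrow> inj_on (z i) {1..l i}"
    and w: "\<And>i j. i \<in> {1..s} \<Longrightarrow> j \<in> {1..l i} \<Longrightarrow> w i j \<noteq> 0"
    and \<Omega>: "\<Omega> \<noteq> {}"
    and nonconst: "nonconstant (L_mat n k s A B C D X Y l g z w)"
    and minimal: "minimal_in \<Omega> (L_mat n k s A B C D X Y l g z w) (state_mat n s l z w)"
  shows "block_full_rank_linearization \<Omega> (L_mat n k s A B C D X Y l g z w)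
           (R_mat n k s A B C D f l g z w) (state_mat n s l z w)"
proof -
  let ?is = "[1..<Suc s]"
  define St where "St = state_mat n s l z w"
  define E where "E i = EF_pencil (l i) (z i) (w i)" for i
  define a where "a i = const_pmat (transpose_mat (a_col (l i) (g i) (z i) (w i)))" for i
  define b where "b i = const_pmat (b_col (l i))" for i
  define bs where "bs = const_pmat (b_stack s l)"
  define F where "F = mat k 1 (\<lambda>(i, _). f i)"
  define U :: pmat where "U = mat 1 k (\<lambda>(_, j). if j = 0 then 1 else 0)"
  define P where "P = pencil X Y"
  define M where "M = row_blocks n (map (\<lambda>i. pencil (A i) (B i)) [0..<k])"
  define Q where "Q = row_blocks n (map (\<lambda>i. a i \<otimes>\<^sub>K pencil (C i) (D i)) ?is)"
  define K where "K = P \<otimes>\<^sub>K 1\<^sub>m n"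
  define Bb where "Bb = (- bs) \<otimes>\<^sub>K 1\<^sub>m n"
  define Bm where "Bm = Bb @\<^sub>c 0\<^sub>m (dim_row St) ((k - 1) * n)"
  define m where "m = sum_list (map l ?is)"
  define r where "r = (k - 1) * n"
  define N where "N = m * n"
  let ?I = "1\<^sub>m n :: pmat"
  have set_is: "set ?is = {1..s}" by auto
  have kn: "n + r = k * n" using k by (cases k) (auto simp: r_def)

  have E: "E i \<in> carrier_mat (l i) (l i)" and a: "a i \<in> carrier_mat 1 (l i)" and b: "b i \<in> carrier_mat (l i) 1" for i
    using a_col_carrier[of "l i" "g i" "z i" "w i"] b_col_carrier[of "l i"]
    by (simp_all add: E_def a_def b_def)
  have AB_pencil: "pencil (A i) (B i) \<in> carrier_mat n n" if "i < k" for i using AB[OF that] by auto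
  have CD_pencil: "pencil (C i) (D i) \<in> carrier_mat n n" if "i \<in> {1..s}" for i using CD[OF that] by auto
  have St_eq: "St = diag_block_mat (map E ?is) \<otimes>\<^sub>K ?I"
    by (simp add: St_def state_mat_def EF_diag_def E_def[abs_def])
  have Ed: "diag_block_mat (map E ?is) \<in> carrier_mat m m"
    unfolding m_def by (rule diag_block_mat_map_carrier) (rule E)
  have St: "St \<in> carrier_mat N N" using kron_carrier[OF Ed one_carrier_mat[of n]] by (simp add: St_eq N_def)
  have bs_eq: "bs = col_blocks 1 (map b ?is)" unfolding bs_def const_b_stack b_def[abs_def] ..
  have bs: "bs \<in> carrier_mat m 1"
    unfolding bs_eq m_def by (rule col_blocks_map_carrier) (rule b)
  have F: "F \<in> carrier_mat k 1" and U: "U \<in> carrier_mat 1 k" by (simp_all add: F_def U_def)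
  have P: "P \<in> carrier_mat (k - 1) k" using XY by (auto simp: P_def)
  have K: "K \<in> carrier_mat r (k * n)" using kron_carrier[OF P one_carrier_mat[of n]] by (simp add: K_def r_def)
  have Bb: "Bb \<in> carrier_mat N n"
    using kron_carrier[of "- bs" m 1 ?I n n] bs by (simp add: Bb_def N_def)
  have Bm: "Bm \<in> carrier_mat N (k * n)"
    using append_cols_carrier[OF Bb zero_carrier_mat[of N r]] St by (simp add: Bm_def kn r_def[symmetric] del: One_nat_def)
  have FI: "F \<otimes>\<^sub>K ?I \<in> carrier_mat (k * n) n" and UI: "U \<otimes>\<^sub>K ?I \<in> carrier_mat n (k * n)"
    using kron_carrier[OF F one_carrier_mat[of n]] kron_carrier[OF U one_carrier_mat[of n]] by simp_all
  have M: "M \<in> carrier_mat n (k * n)"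
    using row_blocks_map_carrier[of "[0..<k]" "\<lambda>i. pencil (A i) (B i)" n "\<lambda>_. n"] AB_pencil
    by (simp add: M_def sum_list_triv)
  have "Q \<in> carrier_mat n (sum_list (map (\<lambda>i. l i * n) ?is))"
    unfolding Q_def
  proof (rule row_blocks_map_carrier)
    fix i assume "i \<in> set ?is"
    then have "i \<in> {1..s}" by auto
    then show "a i \<otimes>\<^sub>K pencil (C i) (D i) \<in> carrier_mat n (l i * n)"
      using kron_carrier[OF a[of i] CD_pencil[of i]] by simp
  qed
  then have Q: "Q \<in> carrier_mat n N" by (simp only: N_def m_def sum_list_mult_const)

  have L_eq: "L_mat n k s A B C D X Y l g z w = four_block_mat (M @\<^sub>r K) (Q @\<^sub>r 0\<^sub>m r N) Bm St"
    using St unfolding L_mat_def Let_def M_def K_def Q_def Bm_def Bb_def St_def P_def a_def bs_def r_def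
    by simp

  \<comment> \<open>The only entry of this product is \<open>f 0 = 1\<close>.\<close>
  have UF: "U * F = 1\<^sub>m 1"
  proof (rule eq_matI)
    fix i j assume "i < dim_row (1\<^sub>m 1 :: pmat)" "j < dim_col (1\<^sub>m 1 :: pmat)"
    then show "(U * F) $$ (i, j) = 1\<^sub>m 1 $$ (i, j)"
      using k f0 U F by (simp add: U_def F_def scalar_prod_def if_distrib if_distribR sum.delta cong: if_cong)
  qed (use U F in auto)
  have UFI: "(U \<otimes>\<^sub>K ?I) * (F \<otimes>\<^sub>K ?I) = ?I"
    using kron_mult[OF U one_carrier_mat F one_carrier_mat, of n] UF by (simp add: kron_one_one)
  have Bm_eq: "Bm = Bb * (U \<otimes>\<^sub>K ?I)"
  proof -
    have "Bb * (U \<otimes>\<^sub>K ?I) = Bb * (1\<^sub>m n @\<^sub>c 0\<^sub>m n r)"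
      unfolding U_def r_def by (subst kron_unit_row[OF k]) (rule refl)
    also have "\<dots> = (Bb * 1\<^sub>m n) @\<^sub>c (Bb * 0\<^sub>m n r)"
      by (rule mult_append_cols[OF Bb]) auto
    finally show ?thesis using Bb St by (simp add: Bm_def r_def)
  qed
  have PF: "P * F = 0\<^sub>m (k - 1) 1"
  proof (rule mat_col_eqI)
    fix j assume "j < dim_col (0\<^sub>m (k - 1) 1 :: pmat)"
    then have j: "j = 0" by simp
    have "col F 0 = vec k f" using k by (intro eq_vecI) (auto simp: F_def)
    then show "col (P * F) j = col (0\<^sub>m (k - 1) 1) j"
      using f_rel col_mult2[OF P F, of 0] j by (simp add: P_def)
  qed (use P F in auto)
  have KF: "K * (F \<otimes>\<^sub>K ?I) = 0\<^sub>m r n"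
    using kron_mult[OF P one_carrier_mat F one_carrier_mat, of n] PF by (simp add: K_def kron_zero_left r_def)

  have is_pencil_K: "is_pencil K"
    unfolding K_def
    by (rule is_pencil_kron[where a = 1 and b = 0])
      (use is_pencil_pencil[of Y X] XY in \<open>auto simp: P_def is_pencil_iff\<close>)
  have is_pencil_L: "is_pencil (L_mat n k s A B C D X Y l g z w)"
    unfolding L_eq
  proof (rule is_pencil_four_block_mat)
    have "is_pencil M"
      unfolding M_def
    proof (rule is_pencil_row_blocks)
      fix Z assume "Z \<in> set (map (\<lambda>i. pencil (A i) (B i)) [0..<k])"
      then obtain i where i: "i < k" and Z: "Z = pencil (A i) (B i)" by auto
      have "is_pencil Z" unfolding Z using AB[OF i] by (intro is_pencil_pencil) auto
      then show "is_pencil Z \<and> dim_row Z = n" using AB_pencil[OF i] by (simp add: Z)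
    qed
    then show "is_pencil (M @\<^sub>r K)" using is_pencil_K M K by (intro is_pencil_append_rows) auto
    have "is_pencil Q"
      unfolding Q_def
    proof (rule is_pencil_row_blocks)
      fix Z assume "Z \<in> set (map (\<lambda>i. a i \<otimes>\<^sub>K pencil (C i) (D i)) ?is)"
      then obtain i where i: "i \<in> {1..s}" and Z: "Z = a i \<otimes>\<^sub>K pencil (C i) (D i)"
        unfolding set_map set_is by blast
      have "is_pencil (pencil (C i) (D i))" using CD[OF i] by (intro is_pencil_pencil) auto
      then have "is_pencil Z"
        unfolding Z by (intro is_pencil_kron[where a = 0 and b = 1])
          (auto simp: is_pencil_iff a_def const_pmat_def)
      then show "is_pencil Z \<and> dim_row Z = n" using a[of i] CD_pencil[OF i] by (simp add: Z)
    qed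
    then show "is_pencil (Q @\<^sub>r 0\<^sub>m r N)" using Q by (intro is_pencil_append_rows) auto
    have "is_pencil Bb"
      unfolding Bb_def bs_def
      by (intro is_pencil_kron[where a = 0 and b = 0]) (auto simp: const_pmat_def)
    then show "is_pencil Bm" unfolding Bm_def using Bb St by (intro is_pencil_append_cols) auto
    have "is_pencil (diag_block_mat (map E ?is))"
      by (rule is_pencil_diag_block_mat) (auto simp: E_def is_pencil_EF_pencil)
    then show "is_pencil St"
      unfolding St_eq by (intro is_pencil_kron[where a = 1 and b = 0]) (auto simp: is_pencil_iff)
  qed (use M K Q Bm St kn in auto)

  have "l 1 \<in> set (map l ?is)" unfolding set_map set_is using s by auto
  then have "l 1 \<le> m" unfolding m_def by (intro member_le_sum_list) simp_all
  then have N_pos: "N > 0" using l[of 1] s n by (simp add: N_def)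

  have rank_K: "mrank (peval K x) = r" for x
    using mrank_kron_one[OF peval_carrier[OF P] XY_rank[of x, folded P_def]]
    by (simp add: K_def peval_kron_one r_def)

  have reg: "regular St" using minimal by (auto simp: minimal_in_def system_matrix_def St_def)
  then have det_St: "det (to_rmat St) \<noteq> 0"
    by (simp add: regular_def to_rmat_def to_fract_hom.hom_det)
  have poly_part: "to_rmat M * to_rmat (F \<otimes>\<^sub>K ?I) =
    mat_sum n n {..<k} (\<lambda>i. to_fract (f i) \<cdot>\<^sub>m to_rmat (pencil (A i) (B i)))"
  proof -
    have "to_rmat M * to_rmat (F \<otimes>\<^sub>K ?I) = to_rmat (M * (F \<otimes>\<^sub>K ?I))" by (rule to_rmat_mult[OF M FI, symmetric])
    also have "M * (F \<otimes>\<^sub>K ?I) = mat_sum n n {..<k} (\<lambda>i. f i \<cdot>\<^sub>m pencil (A i) (B i))"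
      unfolding M_def F_def by (rule row_blocks_mult_kron_col[OF AB_pencil])
    also have "to_rmat \<dots> = mat_sum n n {..<k} (\<lambda>i. to_rmat (f i \<cdot>\<^sub>m pencil (A i) (B i)))"
      unfolding to_rmat_def by (rule to_fract_hom.map_mat_mat_sum) (use AB_pencil in auto)
    finally show ?thesis by (simp add: to_rmat_smult)
  qed
  have rat_part: "to_rmat Q * inv_mat (to_rmat St) * to_rmat (- Bb) = mat_sum n n {1..s}
    (\<lambda>i. (to_rmat (a i) * inv_mat (to_rmat (E i)) * to_rmat (b i)) $$ (0, 0) \<cdot>\<^sub>m to_rmat (pencil (C i) (D i)))"
  proof -
    have S_eq: "to_rmat St = diag_block_mat (map (\<lambda>i. to_rmat (E i)) ?is) \<otimes>\<^sub>K 1\<^sub>m n"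
      unfolding St_eq to_rmat_kron to_rmat_one
      by (simp add: to_rmat_def map_mat_diag_block_mat comp_def)
    have b_eq: "to_rmat (- Bb) = col_blocks 1 (map (\<lambda>i. to_rmat (b i)) ?is) \<otimes>\<^sub>K 1\<^sub>m n"
    proof -
      have "- Bb = bs \<otimes>\<^sub>K ?I" unfolding Bb_def by (rule eq_matI) (auto simp: kron_index_bounds)
      moreover have "to_rmat bs = col_blocks 1 (map (\<lambda>i. to_rmat (b i)) ?is)"
        unfolding bs_eq to_rmat_def
        using map_mat_col_blocks[of "map b ?is" 1 to_fract] carrier_matD(2)[OF b]
        by (auto simp: comp_def simp del: upt_Suc)
      ultimately show ?thesis by (simp add: to_rmat_kron)
    qed
    have Q_eq: "to_rmat Q = row_blocks n (map (\<lambda>i. to_rmat (a i) \<otimes>\<^sub>K to_rmat (pencil (C i) (D i))) ?is)"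
    proof -
      have "to_rmat Q = row_blocks n (map to_rmat (map (\<lambda>i. a i \<otimes>\<^sub>K pencil (C i) (D i)) ?is))"
        unfolding Q_def to_rmat_def
      proof (rule map_mat_row_blocks)
        fix Z assume "Z \<in> set (map (\<lambda>i. a i \<otimes>\<^sub>K pencil (C i) (D i)) ?is)"
        then obtain i where "i \<in> {1..s}" "Z = a i \<otimes>\<^sub>K pencil (C i) (D i)"
          unfolding set_map set_is by blast
        then show "dim_row Z = n" using a[of i] CD_pencil[of i] by simp
      qed
      then show ?thesis by (simp add: to_rmat_kron comp_def)
    qed
    have "to_rmat Q * inv_mat (to_rmat St) * to_rmat (- Bb) = mat_sum n n (set ?is)
      (\<lambda>i. (to_rmat (a i) * inv_mat (to_rmat (E i)) * to_rmat (b i)) $$ (0, 0) \<cdot>\<^sub>m to_rmat (pencil (C i) (D i)))"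
      unfolding Q_eq S_eq b_eq
    proof (rule block_diagonal_transfer_function[where m = l])
      fix i assume "i \<in> set ?is"
      then have i: "i \<in> {1..s}" by auto
      have "det (E i) \<noteq> 0"
        unfolding E_def by (rule nonzero_det_EF_pencil[OF n reg[unfolded St_def] i])
      then show "det (to_rmat (E i)) \<noteq> 0" by (simp add: to_rmat_def to_fract_hom.hom_det)
      show "to_rmat (pencil (C i) (D i)) \<in> carrier_mat n n" using CD_pencil[OF i] by auto
    qed (use E a b det_St[unfolded S_eq] in auto)
    then show ?thesis unfolding set_is .
  qed
  have R_eq: "R_mat n k s A B C D f l g z w =
    to_rmat M * to_rmat (F \<otimes>\<^sub>K ?I) + to_rmat Q * inv_mat (to_rmat St) * to_rmat (- Bb)"
    unfolding R_mat_def poly_part rat_part a_def b_def E_def ..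
  have L_eq': "L_mat n k s A B C D X Y l g z w =
    four_block_mat (M @\<^sub>r K) (Q @\<^sub>r 0\<^sub>m (dim_row K) (dim_row St)) (Bb * (U \<otimes>\<^sub>K ?I)) St"
    using K St by (simp add: L_eq Bm_eq)
  show ?thesis
    unfolding R_eq St_def[symmetric] unfolding L_eq'
    by (rule one_sided_block_full_rank_linearization[OF M K kn Q Bb UI FI St N_pos UFI KF rank_K is_pencil_K])
      (use is_pencil_L nonconst minimal in \<open>simp_all add: L_eq' St_def\<close>)
qed

end
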